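(* Let $A\subset\mathbb{R}^d$ be a finite set of sites in general position. The bifiltrations $\textnormal{S-Rhomb}=(\textnormal{S-Rhomb}_{r,k})$ and $\textnormal{S-Del}=(\textnormal{S-Del}_{r,k})$, indexed by $(r,k)\in[0,\infty)\times\mathbb{N}$, are weakly equivalent.
   Context: $\mathbb{N}=\{1,2,\dots\}$. Bifiltrations are indexed by $[0,\infty)\times\mathbb{N}$ with $(r,k)\le(r',k')$ iff $r\le r'$ and $k\ge k'$, and consist of spaces $X_{r,k}$ with $X_{r,k}\subseteq X_{r',k'}$ when $(r,k)\le(r',k')$. A morphism is a family of continuous maps commuting with the inclusions; it is an objectwise homotopy equivalence if each component is a homotopy equivalence; $X,Y$ are weakly equivalent if connected by a finite zigzag of objectwise homotopy equivalences. Each polyhedral or simplicial complex below is regarded as a space via its (geometric) realization. Simplicial side: for $\tilde A\subseteq A$ let $\mathrm{Ball}_r(\tilde A)=\{b: \|b-\tilde a\|\le r\ \forall\tilde a\in\tilde A\}$ and for $|\tilde A|=k$ let $\mathrm{Vor}(\tilde A)=\{b\in\mathbb{R}^d: \|b-\tilde a\|\le\|b-a\|\ \forall\tilde a\in\tilde A, a\in A\setminus\tilde A\}$. Let $\mathrm{Del}^{+}_{r,k}$ be the abstract simplicial complex whose vertices are subsets $\tilde A\subseteq A$ with $|\tilde A|\in\{k,k+1\}$ and whose simplices are the sets $\sigma$ of such subsets with $\bigcap_{\tilde A\in\sigma}(\mathrm{Ball}_r(\tilde A)\cap\mathrm{Vor}(\tilde A))\neq\emptyset$; $\textnormal{S-Del}_{r,k}=\bigcup_{i\ge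 k}\mathrm{Del}^{+}_{r,i}$. Rhomboid side: a $(d-1)$-sphere $S\subset\mathbb{R}^d$ partitions $A=A_{in}\sqcup A_{on}\sqcup A_{out}$. The combinatorial rhomboid of $S$ is $\rho_S=\{A_{in}\cup Q: Q\subseteq A_{on}\}$; a vertex $v=\{a_1,\dots,a_m\}$ is embedded as $(\sum_i a_i,-m)\in\mathbb{R}^{d+1}$ (depth $m$), and the geometric rhomboid is the convex hull of the embedded vertices. The rhomboid tiling is the polyhedral complex of all rhomboids $\rho_S$. For a rhomboid $\rho$, $r_\rho$ is the infimum of radii of spheres $S$ with $\rho_S=\rho$. The sliced rhomboid tiling is obtained by cutting every rhomboid along the hyperplanes $\{x_{d+1}=-j\}$, $j=0,\dots,|A|$; its cells (sliced rhomboids) are the intersections of rhomboids with these hyperplanes and with the slabs $\{j\le-x_{d+1}\le j+1\}$. For a sliced rhomboid $\rho$, $k_\rho$ is the minimum depth of its vertices and $r_\rho:=r_{\rho'}$ with $\rho'$ the smallest-dimensional rhomboid containing $\rho$. $\textnormal{S-Rhomb}_{r,k}$ is the polyhedral complex $\{\rho \text{ sliced rhomboid}: r_\rho\le r, k_\rho\ge k\}$. *)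

theory Defs
  imports "HOL-Analysis.Analysis"
begin

text \<open>A bifiltration indexed by [0,inf) x N (N = {1,2,...}) is modelled as a family
  X r k of topological spaces (abstract topologies on some carrier type); only indices
  with r >= 0 and k >= 1 matter. (r,k) <= (r',k') iff r <= r' and k >= k'.
  Inclusions are subspace inclusions.\<close>

type_synonym 'u bifiltration = "real \<Rightarrow> nat \<Rightarrow> 'u topology"

definition bif_index :: "real \<Rightarrow> nat \<Rightarrow> bool" where
  "bif_index r k \<longleftrightarrow> 0 \<le> r \<and> 1 \<le> k"

definition bif_le :: "real \<Rightarrow> nat \<Rightarrow> real \<Rightarrow> nat \<Rightarrow> bool" where
  "bif_le r k r' k' \<longleftrightarrow> r \<le> r' \<and> k' \<le> k"

definition is_bifiltration :: "'u bifiltration \<Rightarrow> bool" where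
  "is_bifiltration X \<longleftrightarrow>
     (\<forall>r k r' k'. bif_index r k \<and> bif_index r' k' \<and> bif_le r k r' k' \<longrightarrow>
        topspace (X r k) \<subseteq> topspace (X r' k') \<and>
        X r k = subtopology (X r' k') (topspace (X r k)))"

definition bif_morphism :: "'u bifiltration \<Rightarrow> 'v bifiltration \<Rightarrow> (real \<Rightarrow> nat \<Rightarrow> 'u \<Rightarrow> 'v) \<Rightarrow> bool" where
  "bif_morphism X Y f \<longleftrightarrow>
     (\<forall>r k. bif_index r k \<longrightarrow> continuous_map (X r k) (Y r k) (f r k)) \<and>
     (\<forall>r k r' k'. bif_index r k \<and> bif_index r' k' \<and> bif_le r k r' k' \<longrightarrow>
        (\<forall>x\<in>topspace (X r k). f r' k' x = f r k x))"

definition homotopy_equivalence_map :: "'u topology \<Rightarrow> 'v topology \<Rightarrow> ('u \<Rightarrow> 'v) \<Rightarrow> bool" where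
  "homotopy_equivalence_map X Y f \<longleftrightarrow>
     continuous_map X Y f \<and>
     (\<exists>g. continuous_map Y X g \<and>
          homotopic_with (\<lambda>x. True) X X (g \<circ> f) id \<and>
          homotopic_with (\<lambda>x. True) Y Y (f \<circ> g) id)"

definition objectwise_he :: "'u bifiltration \<Rightarrow> 'v bifiltration \<Rightarrow> (real \<Rightarrow> nat \<Rightarrow> 'u \<Rightarrow> 'v) \<Rightarrow> bool" where
  "objectwise_he X Y f \<longleftrightarrow> bif_morphism X Y f \<and>
     (\<forall>r k. bif_index r k \<longrightarrow> homotopy_equivalence_map (X r k) (Y r k) (f r k))"

definition he_linked :: "'u bifiltration \<Rightarrow> 'v bifiltration \<Rightarrow> bool" where
  "he_linked X Y \<longleftrightarrow> (\<exists>f. objectwise_he X Y f) \<or> (\<exists>g. objectwise_he Y X g)"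

text \<open>Weak equivalence: a finite zigzag of objectwise homotopy equivalences.
  Intermediate bifiltrations are taken with carrier type real: every space of cardinality
  at most the continuum (in particular every subspace of a Euclidean space and every
  realization of a countable simplicial/polyhedral complex) is homeomorphic to a topology
  on real, so this is the usual notion for all spaces of interest.\<close>
definition weakly_equivalent :: "'u bifiltration \<Rightarrow> 'v bifiltration \<Rightarrow> bool" where
  "weakly_equivalent X Y \<longleftrightarrow> is_bifiltration X \<and> is_bifiltration Y \<and>
     (he_linked X Y \<or>
      (\<exists>Zs :: real bifiltration list. Zs \<noteq> [] \<and> (\<forall>Z\<in>set Zs. is_bifiltration Z) \<and>
         he_linked X (hd Zs) \<and>
         (\<forall>i. Suc i < length Zs \<longrightarrow> he_linked (Zs ! i) (Zs ! Suc i)) \<and>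
         he_linked (last Zs) Y))"

definition general_position :: "'a::euclidean_space set \<Rightarrow> bool" where
  "general_position A \<longleftrightarrow>
     (\<forall>B\<subseteq>A. card B \<le> DIM('a) + 1 \<longrightarrow> \<not> affine_dependent B) \<and>
     (\<forall>B\<subseteq>A. card B = DIM('a) + 2 \<longrightarrow> \<not> (\<exists>c \<rho>. 0 < \<rho> \<and> B \<subseteq> sphere c \<rho>))"

definition Ball_r :: "real \<Rightarrow> 'a::euclidean_space set \<Rightarrow> 'a set" where
  "Ball_r r At = {b. \<forall>a\<in>At. norm (b - a) \<le> r}"

definition Vor :: "'a::euclidean_space set \<Rightarrow> 'a set \<Rightarrow> 'a set" where
  "Vor A At = {b. \<forall>x\<in>At. \<forall>a\<in>A - At. norm (b - x) \<le> norm (b - a)}"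

definition Del_plus :: "'a::euclidean_space set \<Rightarrow> real \<Rightarrow> nat \<Rightarrow> 'a set set set" where
  "Del_plus A r k = {\<sigma>. \<sigma> \<noteq> {} \<and> finite \<sigma> \<and>
      (\<forall>At\<in>\<sigma>. At \<subseteq> A \<and> (card At = k \<or> card At = k + 1)) \<and>
      (\<Inter>At\<in>\<sigma>. Ball_r r At \<inter> Vor A At) \<noteq> {}}"

definition S_Del :: "'a::euclidean_space set \<Rightarrow> real \<Rightarrow> nat \<Rightarrow> 'a set set set" where
  "S_Del A r k = (\<Union>i\<in>{k..}. Del_plus A r i)"

text \<open>Geometric realization of an abstract simplicial complex K (a set of simplices over
  vertex type 'v): barycentric coordinate functions supported on a simplex of K, with the
  subspace topology of the product topology on 'v => real (for finitely many vertices, as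
  here, this is the Euclidean topology).\<close>
definition realization :: "'v set set \<Rightarrow> ('v \<Rightarrow> real) set" where
  "realization K = {t. (\<forall>v. 0 \<le> t v) \<and> {v. t v \<noteq> 0} \<in> K \<and> sum t {v. t v \<noteq> 0} = 1}"

definition S_Del_bif :: "'a::euclidean_space set \<Rightarrow> ('a set \<Rightarrow> real) bifiltration" where
  "S_Del_bif A r k = top_of_set (realization (S_Del A r k))"

definition A_in :: "'a::euclidean_space set \<Rightarrow> 'a \<Rightarrow> real \<Rightarrow> 'a set" where
  "A_in A c \<rho> = {a\<in>A. dist c a < \<rho>}"

definition A_on :: "'a::euclidean_space set \<Rightarrow> 'a \<Rightarrow> real \<Rightarrow> 'a set" where
  "A_on A c \<rho> = {a\<in>A. dist c a = \<rho>}"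

definition comb_rhomboid :: "'a::euclidean_space set \<Rightarrow> 'a \<Rightarrow> real \<Rightarrow> 'a set set" where
  "comb_rhomboid A c \<rho> = {A_in A c \<rho> \<union> Q | Q. Q \<subseteq> A_on A c \<rho>}"

definition rhomboids :: "'a::euclidean_space set \<Rightarrow> 'a set set set" where
  "rhomboids A = {comb_rhomboid A c \<rho> | c \<rho>. 0 < \<rho>}"

definition embed_vertex :: "'a::euclidean_space set \<Rightarrow> 'a \<times> real" where
  "embed_vertex v = (\<Sum>a\<in>v. a, - real (card v))"

definition geom_rhomboid :: "'a::euclidean_space set set \<Rightarrow> ('a \<times> real) set" where
  "geom_rhomboid R = convex hull (embed_vertex ` R)"

definition rhomb_radius :: "'a::euclidean_space set \<Rightarrow> 'a set set \<Rightarrow> real" where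
  "rhomb_radius A R = Inf {\<rho>. 0 < \<rho> \<and> (\<exists>c. comb_rhomboid A c \<rho> = R)}"

definition sliced_rhomboids :: "'a::euclidean_space set \<Rightarrow> ('a \<times> real) set set" where
  "sliced_rhomboids A =
     {C. C \<noteq> {} \<and> (\<exists>R\<in>rhomboids A. \<exists>j\<in>{0..card A}.
          C = geom_rhomboid R \<inter> {x. snd x = - real j} \<or>
          C = geom_rhomboid R \<inter> {x. real j \<le> - snd x \<and> - snd x \<le> real j + 1})}"

definition sliced_k_ge :: "('a::euclidean_space \<times> real) set \<Rightarrow> nat \<Rightarrow> bool" where
  "sliced_k_ge C k \<longleftrightarrow> (\<forall>v. v extreme_point_of C \<longrightarrow> real k \<le> - snd v)"

text \<open>The smallest-dimensional rhomboids containing a sliced rhomboid, and r_rho for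
  sliced rhomboids (the minimal rhomboid is unique for a rhomboid tiling; the infimum
  below is just a total way of writing r_(rho')).\<close>
definition minimal_containing_rhomboids :: "'a::euclidean_space set \<Rightarrow> ('a \<times> real) set \<Rightarrow> 'a set set set" where
  "minimal_containing_rhomboids A C =
     {R\<in>rhomboids A. C \<subseteq> geom_rhomboid R \<and>
        (\<forall>R'\<in>rhomboids A. C \<subseteq> geom_rhomboid R' \<longrightarrow>
           aff_dim (geom_rhomboid R) \<le> aff_dim (geom_rhomboid R'))}"

definition sliced_radius :: "'a::euclidean_space set \<Rightarrow> ('a \<times> real) set \<Rightarrow> real" where
  "sliced_radius A C = Inf (rhomb_radius A ` minimal_containing_rhomboids A C)"

definition S_Rhomb :: "'a::euclidean_space set \<Rightarrow> real \<Rightarrow> nat \<Rightarrow> ('a \<times> real) set" where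
  "S_Rhomb A r k = \<Union>{C\<in>sliced_rhomboids A. sliced_radius A C \<le> r \<and> sliced_k_ge C k}"

definition S_Rhomb_bif :: "'a::euclidean_space set \<Rightarrow> ('a \<times> real) bifiltration" where
  "S_Rhomb_bif A r k = top_of_set (S_Rhomb A r k)"

end

theory Submission
  imports Defs
begin

text \<open>Describe a point of the rhomboid tiling by weights \<open>l : A \<rightarrow> [0,1]\<close>: there is a sphere with
  \<open>l = 1\<close> inside it, \<open>l = 0\<close> outside it, and \<open>l\<close> arbitrary on it; the point is
  \<open>(\<Sum>a. l a a, - \<Sum>a. l a)\<close>. General position makes this parametrisation injective. Sending a vertex
  \<open>B\<close> of the Delaunay complex to \<open>embed_vertex B\<close> and extending affinely gives a map
  \<open>|S_Del| \<rightarrow> S_Rhomb\<close> compatible with the inclusions. In weight coordinates it sends a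
  probability vector \<open>t\<close> on subsets of \<open>A\<close> to its mean \<open>\<Sum>B. t B 1\<^sub>B\<close>, and the fibre over \<open>l\<close>
  consists of all \<open>t\<close> with mean \<open>l\<close> supported on subsets of the two sizes next to \<open>\<Sum>a. l a\<close>.
  The fibres are thus convex, and systematic sampling is a continuous section, so the map is a
  homotopy equivalence for every \<open>(r,k)\<close>; no longer zigzag is needed.\<close>

section \<open>Systematic sampling\<close>

text \<open>Weights are total functions pinned to zero off \<open>A\<close>, so equality on
  \<open>A\<close> is equality of functions and the product topology applies.\<close>

definition cube :: "'v set \<Rightarrow> ('v \<Rightarrow> real) set" where
  "cube A = {l. (\<forall>a\<in>A. 0 \<le> l a \<and> l a \<le> 1) \<and> (\<forall>a. a \<notin> A \<longrightarrow> l a = 0)}"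

text \<open>For a probability vector on \<open>Pow A\<close> these are the inclusion probabilities
  of a random subset.\<close>

definition mean :: "'v set \<Rightarrow> ('v set \<Rightarrow> real) \<Rightarrow> 'v \<Rightarrow> real" where
  "mean A t a = (\<Sum>B | B \<subseteq> A \<and> a \<in> B. t B)"

text \<open>The probability space of the random offset; the half-open interval makes the floor of
  the offset itself 0.\<close>

definition unit_lborel :: "real measure" where
  "unit_lborel = restrict_space lborel {0..<1}"

lemma space_unit_lborel: "space unit_lborel = {0..<1}"
  by (simp add: unit_lborel_def space_restrict_space)

lemma measure_unit_lborel: "S \<in> sets borel \<Longrightarrow> S \<subseteq> {0..<1} \<Longrightarrow> measure unit_lborel S = measure lborel S"
  unfolding unit_lborel_def by (rule measure_restrict_space) auto

lemma finite_measure_unit_lborel: "finite_measure unit_lborel"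
  by (rule finite_measureI) (simp add: unit_lborel_def space_restrict_space emeasure_restrict_space)

interpretation unit_lborel: finite_measure unit_lborel
  by (rule finite_measure_unit_lborel)

section \<open>Floors of uniformly shifted reals\<close>

lemma measurable_floor_shift [measurable]:
  "(\<lambda>u. \<lfloor>x + u\<rfloor>) \<in> measurable unit_lborel (count_space UNIV)" for x :: real
  unfolding unit_lborel_def by (rule measurable_restrict_space1) measurable

text \<open>An offset below 1 passes at most one integer, exactly when it reaches
  \<open>1 - frac x\<close>; for integral \<open>x\<close> the interval is empty.\<close>

lemma floor_shift_eq:
  assumes "u \<in> {0..<1::real}"
  shows "real_of_int \<lfloor>x + u\<rfloor> = real_of_int \<lfloor>x\<rfloor> + indicator {1 - frac x..<1} u"
proof (cases "u < 1 - frac x")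
  case True
  then have "\<lfloor>x + u\<rfloor> = \<lfloor>x\<rfloor>"
    using assms by (simp add: floor_unique frac_def) linarith
  with True show ?thesis by auto
next
  case False
  then have "\<lfloor>x + u\<rfloor> = \<lfloor>x\<rfloor> + 1"
    using assms frac_lt_1[of x] by (intro floor_unique) (auto simp: frac_def)
  with False assms show ?thesis by auto
qed

lemma integrable_floor_shift: "integrable unit_lborel (\<lambda>u. real_of_int \<lfloor>x + u\<rfloor>)"
  by (rule unit_lborel.integrable_const_bound[where B = "\<bar>real_of_int \<lfloor>x\<rfloor>\<bar> + 1"])
     (auto simp: floor_shift_eq space_unit_lborel indicator_def intro!: AE_I2)

text \<open>The floor gains one on a set of offsets of length \<open>frac x\<close>: rounding after
  a uniform shift is unbiased.\<close>

lemma integral_floor_shift: "integral\<^sup>L unit_lborel (\<lambda>u. real_of_int \<lfloor>x + u\<rfloor>) = x"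
proof -
  have S: "{1 - frac x..<1} \<in> sets unit_lborel"
    using frac_lt_1[of x] by (auto simp: unit_lborel_def sets_restrict_space_iff)
  have "integral\<^sup>L unit_lborel (\<lambda>u. real_of_int \<lfloor>x + u\<rfloor>)
      = integral\<^sup>L unit_lborel (\<lambda>u. real_of_int \<lfloor>x\<rfloor> + indicator {1 - frac x..<1} u)"
    by (rule Bochner_Integration.integral_cong[OF refl]) (simp add: floor_shift_eq space_unit_lborel)
  also have "\<dots> = real_of_int \<lfloor>x\<rfloor> * measure unit_lborel (space unit_lborel)
      + measure unit_lborel {1 - frac x..<1}"
    using S sets.sets_into_space[OF S]
    by (subst Bochner_Integration.integral_add) (auto simp: unit_lborel.emeasure_eq_measure Int_absorb2)
  also have "\<dots> = real_of_int \<lfloor>x\<rfloor> + frac x"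
    using frac_lt_1[of x] by (simp add: measure_unit_lborel space_unit_lborel)
  finally show ?thesis by (simp add: frac_def)
qed

text \<open>For \<open>x \<le> y\<close> the difference of the floors is a nonnegative integer, so
  it dominates the indicator of the event; its integral is \<open>y - x\<close>.\<close>

lemma measure_floor_shift_neq:
  "measure unit_lborel {u \<in> space unit_lborel. \<lfloor>x + u\<rfloor> \<noteq> \<lfloor>y + u\<rfloor>} \<le> \<bar>x - y\<bar>" for x y :: real
proof (induction x y rule: linorder_wlog)
  case (le x y)
  let ?D = "{u \<in> space unit_lborel. \<lfloor>x + u\<rfloor> \<noteq> \<lfloor>y + u\<rfloor>}"
  have D: "?D \<in> sets unit_lborel" by measurable
  have "measure unit_lborel ?D = integral\<^sup>L unit_lborel (indicator ?D)"
    using D by (simp add: Int_absorb2)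
  also have "\<dots> \<le> integral\<^sup>L unit_lborel (\<lambda>u. real_of_int \<lfloor>y + u\<rfloor> - real_of_int \<lfloor>x + u\<rfloor>)"
  proof (rule integral_mono)
    show "indicator ?D u \<le> real_of_int \<lfloor>y + u\<rfloor> - real_of_int \<lfloor>x + u\<rfloor>" for u
    proof -
      have "\<lfloor>x + u\<rfloor> \<le> \<lfloor>y + u\<rfloor>" using le by (intro floor_mono) auto
      then show ?thesis by (auto simp: indicator_def)
    qed
  qed (use D in \<open>auto intro!: integrable_floor_shift simp: unit_lborel.emeasure_eq_measure\<close>)
  also have "\<dots> = y - x"
    by (simp add: integrable_floor_shift integral_floor_shift)
  finally show ?case by simp
next
  case (sym x y)
  then show ?case by (simp add: abs_minus_commute eq_commute)
qed

definition cumul :: "(nat \<Rightarrow> 'v) \<Rightarrow> ('v \<Rightarrow> real) \<Rightarrow> nat \<Rightarrow> real" where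
  "cumul h l j = (\<Sum>i<j. l (h i))"

text \<open>Systematic sampling: laying the weights end to end on a line, an element is chosen when its
  interval, shifted by \<open>u\<close>, crosses an integer.\<close>

definition sample :: "(nat \<Rightarrow> 'v) \<Rightarrow> nat \<Rightarrow> ('v \<Rightarrow> real) \<Rightarrow> real \<Rightarrow> 'v set" where
  "sample h n l u = h ` {j. j < n \<and> \<lfloor>cumul h l j + u\<rfloor> \<noteq> \<lfloor>cumul h l (Suc j) + u\<rfloor>}"

definition sample_weight :: "(nat \<Rightarrow> 'v) \<Rightarrow> nat \<Rightarrow> ('v \<Rightarrow> real) \<Rightarrow> 'v set \<Rightarrow> real" where
  "sample_weight h n l B = measure unit_lborel {u \<in> space unit_lborel. sample h n l u = B}"

context
  fixes A :: "'v set" and h :: "nat \<Rightarrow> 'v" and n :: nat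
  assumes h: "bij_betw h {..<n} A"
begin

lemma enum_mem: "j < n \<Longrightarrow> h j \<in> A"
  using h by (auto simp: bij_betw_def)

lemma enum_in_sample:
  assumes "j < n"
  shows "h j \<in> sample h n l u \<longleftrightarrow> \<lfloor>cumul h l j + u\<rfloor> \<noteq> \<lfloor>cumul h l (Suc j) + u\<rfloor>"
  using h assms by (auto simp: sample_def bij_betw_def inj_on_def)

lemma sample_subset: "sample h n l u \<subseteq> A"
  using h by (auto simp: sample_def bij_betw_def)

text \<open>An interval of length at most 1 crosses at most one integer, so the floor jumps by 0 or
  1.\<close>

lemma floor_cumul_Suc:
  assumes "l \<in> cube A" "j < n"
  shows "real_of_int \<lfloor>cumul h l (Suc j) + u\<rfloor> - real_of_int \<lfloor>cumul h l j + u\<rfloor>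
    = of_bool (h j \<in> sample h n l u)"
proof -
  have "0 \<le> l (h j)" "l (h j) \<le> 1"
    using assms enum_mem by (auto simp: cube_def)
  then have "\<lfloor>cumul h l j + u\<rfloor> \<le> \<lfloor>cumul h l (Suc j) + u\<rfloor>"
      "\<lfloor>cumul h l (Suc j) + u\<rfloor> \<le> \<lfloor>cumul h l j + u + 1\<rfloor>"
    unfolding cumul_def by (intro floor_mono; simp)+
  then show ?thesis
    using assms by (auto simp: enum_in_sample of_bool_def)
qed

text \<open>The jumps telescope, starting from the floor of \<open>u\<close>, which is 0. Thus only
  two sizes can occur, whatever the offset.\<close>

lemma card_sample:
  assumes "l \<in> cube A" "u \<in> {0..<1}"
  shows "int (card (sample h n l u)) = \<lfloor>sum l A + u\<rfloor>"
proof -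
  let ?J = "{j. j < n \<and> \<lfloor>cumul h l j + u\<rfloor> \<noteq> \<lfloor>cumul h l (Suc j) + u\<rfloor>}"
  have "inj_on h ?J"
    using h by (auto simp: bij_betw_def inj_on_def)
  then have "card (sample h n l u) = card ?J"
    unfolding sample_def by (rule card_image)
  then have "real (card (sample h n l u)) = (\<Sum>j<n. of_bool (h j \<in> sample h n l u))"
    using enum_in_sample by (simp add: of_bool_def sum.If_cases Int_def conj_commute cong: conj_cong)
  also have "\<dots> = (\<Sum>j<n. real_of_int \<lfloor>cumul h l (Suc j) + u\<rfloor> - real_of_int \<lfloor>cumul h l j + u\<rfloor>)"
    using assms floor_cumul_Suc by (intro sum.cong) auto
  also have "\<dots> = real_of_int \<lfloor>cumul h l n + u\<rfloor> - real_of_int \<lfloor>cumul h l 0 + u\<rfloor>"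
    by (rule sum_lessThan_telescope)
  also have "cumul h l n = sum l A"
    unfolding cumul_def using sum.reindex_bij_betw[OF h] .
  finally show ?thesis
    using assms by (simp add: cumul_def floor_unique[of 0 u])
qed

text \<open>An interval of length 1 crosses an integer for every offset, one of length 0 for
  none.\<close>

lemma sample_sandwich:
  assumes "l \<in> cube A"
  shows "{a \<in> A. l a = 1} \<subseteq> sample h n l u" "sample h n l u \<subseteq> {a \<in> A. 0 < l a}"
proof -
  have eq: "cumul h l (Suc j) = cumul h l j + l (h j)" for j by (simp add: cumul_def)
  show "{a \<in> A. l a = 1} \<subseteq> sample h n l u"
  proof clarify
    fix a assume "a \<in> A" "l a = 1"
    then obtain j where "j < n" "a = h j" using h by (auto simp: bij_betw_def)
    moreover have "\<lfloor>cumul h l (Suc j) + u\<rfloor> = \<lfloor>cumul h l j + u\<rfloor> + 1"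
      using \<open>a = h j\<close> \<open>l a = 1\<close> eq[of j] by (simp add: floor_eq_iff) linarith
    ultimately show "a \<in> sample h n l u" using enum_in_sample by simp
  qed
  show "sample h n l u \<subseteq> {a \<in> A. 0 < l a}"
  proof
    fix a assume a: "a \<in> sample h n l u"
    then obtain j where j: "j < n" "a = h j" by (auto simp: sample_def)
    then have "\<lfloor>cumul h l j + u\<rfloor> \<noteq> \<lfloor>cumul h l j + l a + u\<rfloor>"
      using a enum_in_sample[of j l u] eq[of j] by simp
    then have "l a \<noteq> 0" by auto
    with assms j enum_mem show "a \<in> {a \<in> A. 0 < l a}" by (force simp: cube_def)
  qed
qed

lemma sample_event [measurable]: "{u \<in> space unit_lborel. sample h n l u = B} \<in> sets unit_lborel"
proof -
  have "sample h n l u = B \<longleftrightarrow>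
     B \<subseteq> A \<and> (\<forall>j\<in>{..<n}. h j \<in> B \<longleftrightarrow> \<lfloor>cumul h l j + u\<rfloor> \<noteq> \<lfloor>cumul h l (Suc j) + u\<rfloor>)" for u
  proof
    assume R: "B \<subseteq> A \<and> (\<forall>j\<in>{..<n}. h j \<in> B \<longleftrightarrow> \<lfloor>cumul h l j + u\<rfloor> \<noteq> \<lfloor>cumul h l (Suc j) + u\<rfloor>)"
    show "sample h n l u = B"
    proof (rule set_eqI)
      fix a
      show "a \<in> sample h n l u \<longleftrightarrow> a \<in> B"
      proof (cases "a \<in> A")
        case True
        then obtain j where "j < n" "a = h j" using h by (auto simp: bij_betw_def)
        then show ?thesis using R enum_in_sample by auto
      qed (use R sample_subset in blast)
    qed
  qed (use enum_in_sample sample_subset in blast)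
  then show ?thesis by simp
qed

section \<open>The law of the sample\<close>

lemma sum_sample_weight:
  assumes "finite F"
  shows "(\<Sum>B\<in>F. sample_weight h n l B) = measure unit_lborel {u \<in> space unit_lborel. sample h n l u \<in> F}"
proof -
  have "(\<Sum>B\<in>F. sample_weight h n l B)
      = measure unit_lborel (\<Union>B\<in>F. {u \<in> space unit_lborel. sample h n l u = B})"
    unfolding sample_weight_def
    by (rule unit_lborel.finite_measure_finite_Union[symmetric])
       (use assms sample_event in \<open>auto simp: disjoint_family_on_def\<close>)
  also have "(\<Union>B\<in>F. {u \<in> space unit_lborel. sample h n l u = B}) = {u \<in> space unit_lborel. sample h n l u \<in> F}"
    by auto
  finally show ?thesis .
qed

lemma finite_enumerated: "finite A"
  using h bij_betw_finite by blast

lemma sum_sample_weight_Pow: "sum (sample_weight h n l) (Pow A) = 1"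
proof -
  have "sum (sample_weight h n l) (Pow A) = measure unit_lborel (space unit_lborel)"
    using sample_subset finite_enumerated by (simp add: sum_sample_weight)
  then show ?thesis by (simp add: space_unit_lborel measure_unit_lborel)
qed

text \<open>The probability of choosing \<open>h j\<close> is the expected jump of the floor over
  its interval, which by unbiased rounding is the length of the interval.\<close>

lemma mean_sample_weight:
  assumes "l \<in> cube A"
  shows "mean A (sample_weight h n l) = l"
proof
  fix a
  show "mean A (sample_weight h n l) a = l a"
  proof (cases "a \<in> A")
    case True
    then obtain j where j: "j < n" "a = h j" using h by (auto simp: bij_betw_def)
    let ?E = "{u \<in> space unit_lborel. a \<in> sample h n l u}"
    have E: "?E \<in> sets unit_lborel"
      unfolding j(2) enum_in_sample[OF j(1)] by measurable
    have "mean A (sample_weight h n l) a = measure unit_lborel ?E"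
      unfolding mean_def using sample_subset finite_enumerated by (subst sum_sample_weight) auto
    also have "\<dots> = integral\<^sup>L unit_lborel (indicator ?E)"
      using E by (simp add: Int_absorb2)
    also have "\<dots> = integral\<^sup>L unit_lborel
        (\<lambda>u. real_of_int \<lfloor>cumul h l (Suc j) + u\<rfloor> - real_of_int \<lfloor>cumul h l j + u\<rfloor>)"
      by (rule Bochner_Integration.integral_cong[OF refl])
         (use assms j in \<open>simp add: floor_cumul_Suc indicator_def\<close>)
    also have "\<dots> = cumul h l (Suc j) - cumul h l j"
      by (simp add: integrable_floor_shift integral_floor_shift)
    also have "\<dots> = l a"
      using j by (simp add: cumul_def)
    finally show ?thesis .
  next
    case False
    then have "{B. B \<subseteq> A \<and> a \<in> B} = {}" by auto
    with False assms show ?thesis by (simp only: mean_def) (simp add: cube_def)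
  qed
qed

text \<open>The sample depends only on the floors of the shifted partial sums, so two weight vectors
  give the same sample unless one of finitely many floors differs; a union bound finishes.\<close>

lemma sample_weight_lipschitz:
  "\<bar>sample_weight h n l B - sample_weight h n l' B\<bar> \<le> (\<Sum>j\<le>n. \<bar>cumul h l j - cumul h l' j\<bar>)"
proof -
  let ?D = "\<lambda>j. {u \<in> space unit_lborel. \<lfloor>cumul h l j + u\<rfloor> \<noteq> \<lfloor>cumul h l' j + u\<rfloor>}"
  let ?E = "\<lambda>l. {u \<in> space unit_lborel. sample h n l u = B}"
  have D: "?D j \<in> sets unit_lborel" for j by measurable
  have same: "sample h n l u = sample h n l' u" if "u \<in> space unit_lborel" "u \<notin> (\<Union>j\<le>n. ?D j)" for u
  proof -
    have "\<lfloor>cumul h l j + u\<rfloor> = \<lfloor>cumul h l' j + u\<rfloor>" if "j \<le> n" for j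
      using that \<open>u \<notin> _\<close> \<open>u \<in> _\<close> by auto
    then have "{j. j < n \<and> \<lfloor>cumul h l j + u\<rfloor> \<noteq> \<lfloor>cumul h l (Suc j) + u\<rfloor>}
        = {j. j < n \<and> \<lfloor>cumul h l' j + u\<rfloor> \<noteq> \<lfloor>cumul h l' (Suc j) + u\<rfloor>}"
      by (intro Collect_cong) (simp cong: conj_cong)
    then show ?thesis by (simp only: sample_def)
  qed
  have le: "measure unit_lborel (?E l1) \<le> measure unit_lborel (?E l2) + measure unit_lborel (\<Union>j\<le>n. ?D j)"
    if "?E l1 \<subseteq> ?E l2 \<union> (\<Union>j\<le>n. ?D j)" for l1 l2
  proof -
    have "measure unit_lborel (?E l1) \<le> measure unit_lborel (?E l2 \<union> (\<Union>j\<le>n. ?D j))"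
      by (rule unit_lborel.finite_measure_mono[OF that]) (use D sample_event in auto)
    also have "\<dots> \<le> measure unit_lborel (?E l2) + measure unit_lborel (\<Union>j\<le>n. ?D j)"
      by (rule measure_Un_le) (use D sample_event in auto)
    finally show ?thesis .
  qed
  have "measure unit_lborel (\<Union>j\<le>n. ?D j) \<le> (\<Sum>j\<le>n. measure unit_lborel (?D j))"
    by (rule unit_lborel.finite_measure_subadditive_finite) (use D in auto)
  also have "\<dots> \<le> (\<Sum>j\<le>n. \<bar>cumul h l j - cumul h l' j\<bar>)"
    by (intro sum_mono measure_floor_shift_neq)
  finally have "measure unit_lborel (\<Union>j\<le>n. ?D j) \<le> (\<Sum>j\<le>n. \<bar>cumul h l j - cumul h l' j\<bar>)" .
  moreover have "measure unit_lborel (?E l) \<le> measure unit_lborel (?E l') + measure unit_lborel (\<Union>j\<le>n. ?D j)"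
    by (rule le) (use same in auto)
  moreover have "measure unit_lborel (?E l') \<le> measure unit_lborel (?E l) + measure unit_lborel (\<Union>j\<le>n. ?D j)"
    by (rule le) (use same in auto)
  ultimately show ?thesis
    unfolding sample_weight_def by linarith
qed

lemma continuous_on_sample_weight: "continuous_on S (sample_weight h n)"
proof (rule continuous_on_coordinatewise_then_product)
  fix B
  show "continuous_on S (\<lambda>l. sample_weight h n l B)"
    unfolding continuous_on_def
  proof
    fix l assume "l \<in> S"
    have "continuous_on S (\<lambda>l'. \<Sum>j\<le>n. \<bar>cumul h l' j - cumul h l j\<bar>)"
      unfolding cumul_def
      by (intro continuous_intros continuous_on_product_then_coordinatewise[OF continuous_on_id])
    then have "((\<lambda>l'. \<Sum>j\<le>n. \<bar>cumul h l' j - cumul h l j\<bar>) \<longlongrightarrow> 0) (at l within S)"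
      using \<open>l \<in> S\<close> by (force simp: continuous_on_def)
    then have "((\<lambda>l'. sample_weight h n l' B - sample_weight h n l B) \<longlongrightarrow> 0) (at l within S)"
      by (rule Lim_null_comparison[rotated]) (simp add: sample_weight_lipschitz)
    then show "((\<lambda>l'. sample_weight h n l' B) \<longlongrightarrow> sample_weight h n l B) (at l within S)"
      by (simp only: LIM_zero_iff)
  qed
qed

text \<open>Transfers facts valid for every offset to the support of the law.\<close>

lemma sample_weight_support:
  assumes "sample_weight h n l B \<noteq> 0"
  obtains u where "u \<in> {0..<1}" "B = sample h n l u"
proof -
  have "{u \<in> space unit_lborel. sample h n l u = B} \<noteq> {}"
    using assms by (metis sample_weight_def measure_empty)
  then show thesis using that by (auto simp: space_unit_lborel)
qed

end

text \<open>At an integral level the next size up is allowed as well, but a probability vector whose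
  mean size is that level gives it no mass.\<close>

definition near_level :: "real \<Rightarrow> nat \<Rightarrow> bool" where
  "near_level s m \<longleftrightarrow> int m = \<lfloor>s\<rfloor> \<or> int m = \<lfloor>s\<rfloor> + 1"

text \<open>Collects what is used later, with the enumeration hidden: a continuous section of
  \<open>mean A\<close> over the cube with controlled support.\<close>

lemma sampling:
  fixes A :: "'v set"
  assumes "finite A"
  obtains g :: "('v \<Rightarrow> real) \<Rightarrow> 'v set \<Rightarrow> real" where
    "continuous_on UNIV g"
    "\<And>l B. 0 \<le> g l B"
    "\<And>l B. g l B \<noteq> 0 \<Longrightarrow> B \<subseteq> A"
    "\<And>l. sum (g l) (Pow A) = 1"
    "\<And>l. l \<in> cube A \<Longrightarrow> mean A (g l) = l"
    "\<And>l B. l \<in> cube A \<Longrightarrow> g l B \<noteq> 0 \<Longrightarrow>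
      {a \<in> A. l a = 1} \<subseteq> B \<and> B \<subseteq> {a \<in> A. 0 < l a} \<and> near_level (sum l A) (card B)"
proof -
  obtain h :: "nat \<Rightarrow> 'v" where h: "bij_betw h {..<card A} A"
    using ex_bij_betw_nat_finite[OF assms] by (auto simp: atLeast0LessThan)
  show thesis
  proof (rule that[of "sample_weight h (card A)"])
    fix l B assume l: "l \<in> cube A" and "sample_weight h (card A) l B \<noteq> 0"
    then obtain u where u: "u \<in> {0..<1}" "B = sample h (card A) l u"
      using sample_weight_support[OF h] by blast
    have "int (card B) = \<lfloor>sum l A + u\<rfloor>"
      using card_sample[OF h l u(1)] u(2) by simp
    moreover have "\<lfloor>sum l A + u\<rfloor> = \<lfloor>sum l A\<rfloor> \<or> \<lfloor>sum l A + u\<rfloor> = \<lfloor>sum l A\<rfloor> + 1"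
      using u(1) by (simp add: floor_eq_iff) linarith
    ultimately have "near_level (sum l A) (card B)"
      by (simp add: near_level_def)
    then show "{a \<in> A. l a = 1} \<subseteq> B \<and> B \<subseteq> {a \<in> A. 0 < l a} \<and> near_level (sum l A) (card B)"
      using sample_sandwich[OF h l, of u] u(2) by blast
  next
    fix l B assume "sample_weight h (card A) l B \<noteq> 0"
    then show "B \<subseteq> A"
      using sample_weight_support[OF h] sample_subset[OF h] by metis
  qed (use continuous_on_sample_weight[OF h] sum_sample_weight_Pow[OF h] mean_sample_weight[OF h] in \<open>auto simp: sample_weight_def\<close>)
qed

section \<open>The realization of the Delaunay complex\<close>

definition spherical :: "'a::euclidean_space set \<Rightarrow> ('a \<Rightarrow> real) \<Rightarrow> 'a \<Rightarrow> real \<Rightarrow> bool" where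
  "spherical A l c \<rho> \<longleftrightarrow> (\<forall>a\<in>A. (l a < 1 \<longrightarrow> \<rho> \<le> dist c a) \<and> (0 < l a \<longrightarrow> dist c a \<le> \<rho>))"

definition del_weights :: "'a::euclidean_space set \<Rightarrow> real \<Rightarrow> nat \<Rightarrow> ('a \<Rightarrow> real) set" where
  "del_weights A r k = {l \<in> cube A. real k \<le> sum l A \<and> (\<exists>c \<rho>. 0 \<le> \<rho> \<and> \<rho> \<le> r \<and> spherical A l c \<rho>)}"

text \<open>An interchange of summation. Taking \<open>f\<close> to be the identity gives the
  position of the lifted point, the constant 1 gives the size.\<close>

lemma sum_mean_scaleR:
  fixes f :: "'v \<Rightarrow> 'b::real_vector"
  assumes "finite A"
  shows "(\<Sum>a\<in>A. mean A t a *\<^sub>R f a) = (\<Sum>B\<in>Pow A. t B *\<^sub>R (\<Sum>a\<in>B. f a))"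
proof -
  have "(\<Sum>a\<in>A. mean A t a *\<^sub>R f a) = (\<Sum>a\<in>A. \<Sum>B\<in>{B \<in> Pow A. a \<in> B}. t B *\<^sub>R f a)"
    by (simp add: mean_def scaleR_sum_left)
  also have "\<dots> = (\<Sum>B\<in>Pow A. \<Sum>a\<in>{a \<in> A. a \<in> B}. t B *\<^sub>R f a)"
    using assms by (intro sum.swap_restrict) auto
  also have "\<dots> = (\<Sum>B\<in>Pow A. t B *\<^sub>R (\<Sum>a\<in>B. f a))"
  proof (rule sum.cong[OF refl])
    fix B assume "B \<in> Pow A"
    then have "{a \<in> A. a \<in> B} = B" by auto
    then show "(\<Sum>a\<in>{a \<in> A. a \<in> B}. t B *\<^sub>R f a) = t B *\<^sub>R (\<Sum>a\<in>B. f a)"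
      by (simp add: scaleR_sum_right)
  qed
  finally show ?thesis .
qed

lemma sum_mean:
  assumes "finite A"
  shows "sum (mean A t) A = (\<Sum>B\<in>Pow A. t B * real (card B))"
  using sum_mean_scaleR[OF assms, of t "\<lambda>_. 1::real"] by simp

section \<open>Means of probability vectors on subsets\<close>

context
  fixes A :: "'v set" and t :: "'v set \<Rightarrow> real"
  assumes fin: "finite A" and nonneg: "\<And>B. 0 \<le> t B" and total: "sum t (Pow A) = 1"
begin

lemma mean_pos: "B \<subseteq> A \<Longrightarrow> t B \<noteq> 0 \<Longrightarrow> a \<in> B \<Longrightarrow> 0 < mean A t a"
  unfolding mean_def
  by (rule sum_pos2[where i = B]) (use fin nonneg in \<open>auto simp: less_le\<close>)

lemma mean_complement: "mean A t a = 1 - (\<Sum>B | B \<subseteq> A \<and> a \<notin> B. t B)"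
proof -
  have "sum t (Pow A) = (\<Sum>B\<in>{B. B \<subseteq> A \<and> a \<in> B} \<union> {B. B \<subseteq> A \<and> a \<notin> B}. t B)"
    by (rule sum.cong) auto
  also have "\<dots> = (\<Sum>B | B \<subseteq> A \<and> a \<in> B. t B) + (\<Sum>B | B \<subseteq> A \<and> a \<notin> B. t B)"
    using fin by (intro sum.union_disjoint) (auto intro: finite_subset[of _ "Pow A"])
  finally show ?thesis using total by (simp add: mean_def)
qed

lemma mean_less_1: "B \<subseteq> A \<Longrightarrow> t B \<noteq> 0 \<Longrightarrow> a \<notin> B \<Longrightarrow> mean A t a < 1"
proof -
  assume "B \<subseteq> A" "t B \<noteq> 0" "a \<notin> B"
  then have "0 < (\<Sum>B | B \<subseteq> A \<and> a \<notin> B. t B)"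
    by (intro sum_pos2[where i = B]) (use fin nonneg in \<open>auto simp: less_le\<close>)
  then show ?thesis by (simp add: mean_complement)
qed

lemma mean_in_cube: "mean A t \<in> cube A"
proof -
  have "0 \<le> mean A t a" for a
    unfolding mean_def by (rule sum_nonneg) (use nonneg in auto)
  moreover have "mean A t a \<le> 1" for a
    unfolding mean_complement using nonneg by (simp add: sum_nonneg)
  moreover have "mean A t a = 0" if "a \<notin> A" for a
    unfolding mean_def using that by (intro sum.neutral) auto
  ultimately show ?thesis by (simp add: cube_def)
qed

lemma mean_pos_imp: "0 < mean A t a \<Longrightarrow> \<exists>B. B \<subseteq> A \<and> t B \<noteq> 0 \<and> a \<in> B"
  unfolding mean_def by (metis (mono_tags, lifting) less_irrefl mem_Collect_eq sum.neutral)

lemma mean_less_1_imp: "mean A t a < 1 \<Longrightarrow> \<exists>B. B \<subseteq> A \<and> t B \<noteq> 0 \<and> a \<notin> B"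
proof (rule ccontr)
  assume "mean A t a < 1" and "\<nexists>B. B \<subseteq> A \<and> t B \<noteq> 0 \<and> a \<notin> B"
  then have "(\<Sum>B | B \<subseteq> A \<and> a \<notin> B. t B) = 0" by (intro sum.neutral) blast
  with \<open>mean A t a < 1\<close> show False by (simp add: mean_complement)
qed

text \<open>The total of the mean is the average set size, so it lies in \<open>[i, i + 1]\<close>.
  Below \<open>i + 1\<close> its floor is \<open>i\<close>; at \<open>i + 1\<close> all mass sits on
  sets of size \<open>i + 1\<close>.\<close>

lemma sum_mean_between:
  assumes card: "\<And>B. B \<subseteq> A \<Longrightarrow> t B \<noteq> 0 \<Longrightarrow> card B = i \<or> card B = Suc i"
  shows "real i \<le> sum (mean A t) A"
    and "B \<subseteq> A \<Longrightarrow> t B \<noteq> 0 \<Longrightarrow> near_level (sum (mean A t) A) (card B)"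
proof -
  let ?s = "sum (mean A t) A"
  have lower: "?s - real i = (\<Sum>B\<in>Pow A. t B * (real (card B) - real i))"
    using total by (simp add: sum_mean[OF fin] right_diff_distrib sum_subtractf flip: sum_distrib_right)
  have upper: "real i + 1 - ?s = (\<Sum>B\<in>Pow A. t B * (real i + 1 - real (card B)))"
    using total by (simp add: sum_mean[OF fin] right_diff_distrib sum_subtractf flip: sum_distrib_right)
  have up_nonneg: "0 \<le> t B * (real i + 1 - real (card B))" if "B \<in> Pow A" for B
    using card[of B] nonneg[of B] that by (cases "t B = 0") auto
  have "0 \<le> (\<Sum>B\<in>Pow A. t B * (real (card B) - real i))"
    by (rule sum_nonneg) (metis PowD card add_0 cancel_comm_monoid_add_class.diff_cancel diff_ge_0_iff_ge
        lessI less_imp_le mult_eq_0_iff nonneg of_nat_le_iff order_refl split_mult_pos_le)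
  with lower show le: "real i \<le> ?s" by linarith
  have "0 \<le> real i + 1 - ?s"
    unfolding upper using up_nonneg by (rule sum_nonneg)
  then consider "?s < real i + 1" | "?s = real i + 1" by linarith
  then show "near_level ?s (card B)" if B: "B \<subseteq> A" "t B \<noteq> 0"
  proof cases
    case 1
    with le have "\<lfloor>?s\<rfloor> = int i" by (simp add: floor_eq_iff)
    then show ?thesis using card[OF B] by (auto simp: near_level_def)
  next
    case 2
    then have "(\<Sum>B\<in>Pow A. t B * (real i + 1 - real (card B))) = 0" using upper by simp
    then have "t B * (real i + 1 - real (card B)) = 0"
      using B fin up_nonneg by (subst (asm) sum_nonneg_eq_0_iff) auto
    then have "card B = Suc i" using B by auto
    moreover have "\<lfloor>?s\<rfloor> = int (Suc i)" using 2 by simp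
    ultimately show ?thesis by (simp add: near_level_def)
  qed
qed

end

text \<open>A common point of the balls and Voronoi regions serves as centre. The radius is its
  largest distance to a site occurring in the support, which the ball condition bounds by
  \<open>r\<close>.\<close>

lemma Del_plus_imp_spherical:
  fixes A :: "'a::euclidean_space set"
  assumes fin: "finite A" and nonneg: "\<And>B. 0 \<le> t B" and total: "sum t (Pow A) = 1"
    and "1 \<le> i" and supp: "{B. t B \<noteq> 0} \<in> Del_plus A r i"
  shows "\<exists>c \<rho>. 0 \<le> \<rho> \<and> \<rho> \<le> r \<and> spherical A (mean A t) c \<rho>"
proof -
  let ?s = "{B. t B \<noteq> 0}"
  have sub: "\<And>B. t B \<noteq> 0 \<Longrightarrow> B \<subseteq> A" and card: "\<And>B. t B \<noteq> 0 \<Longrightarrow> card B = i \<or> card B = i + 1"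
    and "?s \<noteq> {}"
    using supp by (auto simp: Del_plus_def)
  obtain b where b: "\<And>B. t B \<noteq> 0 \<Longrightarrow> b \<in> Ball_r r B \<inter> Vor A B"
    using supp by (auto simp: Del_plus_def)
  have ball: "dist b a \<le> r" if "t B \<noteq> 0" "a \<in> B" for a B
    using b that by (auto simp: Ball_r_def dist_norm)
  have vor: "dist b x \<le> dist b a" if "t B \<noteq> 0" "x \<in> B" "a \<in> A" "a \<notin> B" for x a B
    using b that by (auto simp: Vor_def dist_norm)
  note mean = mean_pos_imp[OF fin nonneg total] mean_less_1_imp[OF fin nonneg total]
  let ?P = "\<Union>?s"
  have "?P \<noteq> {}" using \<open>?s \<noteq> {}\<close> card \<open>1 \<le> i\<close> by fastforce
  have finP: "finite ?P" using sub fin by (blast intro: finite_subset)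
  define \<rho> where "\<rho> = Max (dist b ` ?P)"
  have "\<rho> \<in> dist b ` ?P"
    unfolding \<rho>_def using finP \<open>?P \<noteq> {}\<close> by (intro Max_in) auto
  then obtain x B where x: "t B \<noteq> 0" "x \<in> B" "\<rho> = dist b x" by auto
  have le: "dist b a \<le> \<rho>" if "0 < mean A t a" for a
    using mean(1)[OF that] finP unfolding \<rho>_def by (intro Max_ge) auto
  have ge: "\<rho> \<le> dist b a" if a: "a \<in> A" "mean A t a < 1" for a
  proof (rule ccontr)
    assume "\<not> \<rho> \<le> dist b a"
    then have ax: "dist b a < dist b x" using x by simp
    \<comment> \<open>\<open>B\<close> contains the farthest site \<open>x\<close>, while
      \<open>C\<close> omits the nearer site \<open>a\<close>. The Voronoi inequalities force
      \<open>C\<close>, \<open>a\<close> and \<open>x\<close> into \<open>B\<close> with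
      \<open>x\<close> outside \<open>C\<close>, so the sizes would differ by two.\<close>
    obtain C where C: "t C \<noteq> 0" "a \<notin> C" using mean(2)[OF a(2)] by blast
    have "a \<in> B" using ax vor[OF x(1,2) a(1)] by force
    have "x \<notin> C" using ax vor[OF C(1) _ a(1) C(2)] by force
    have "y \<in> B" if "y \<in> C" for y
    proof (rule ccontr)
      assume "y \<notin> B"
      then have "dist b x \<le> dist b y" using vor[OF x(1,2)] that sub[OF C(1)] by auto
      moreover have "dist b y \<le> dist b a" using vor[OF C(1) that a(1) C(2)] .
      ultimately show False using ax by simp
    qed
    then have "insert a (insert x C) \<subseteq> B" using \<open>a \<in> B\<close> x(2) by auto
    moreover have "finite B" "finite C" using sub fin x(1) C(1) by (auto intro: finite_subset)
    moreover have "a \<noteq> x" using ax by auto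
    ultimately have "card C + 2 \<le> card B"
      using card_mono[of B "insert a (insert x C)"] \<open>x \<notin> C\<close> C(2) by simp
    with card[OF x(1)] card[OF C(1)] show False by auto
  qed
  show ?thesis
    using le ge ball[OF x(1,2)] x(3) by (intro exI[of _ b] exI[of _ \<rho>]) (auto simp: spherical_def)
qed


text \<open>Apart from being a probability vector on subsets of \<open>A\<close>, membership becomes
  a condition on the mean and on sizes allowed by the mean, so it can be checked within a fibre of
  \<open>mean A\<close>. Conversely, the centre of a sphere for the mean lies in every ball and
  Voronoi region of the support.\<close>

lemma realization_S_Del:
  fixes A :: "'a::euclidean_space set"
  assumes fin: "finite A" and k: "1 \<le> k"
  shows "realization (S_Del A r k) =
    {t. (\<forall>B. 0 \<le> t B) \<and> (\<forall>B. t B \<noteq> 0 \<longrightarrow> B \<subseteq> A \<and> near_level (sum (mean A t) A) (card B)) \<and>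
      sum t (Pow A) = 1 \<and> mean A t \<in> del_weights A r k}" (is "?L = ?R")
proof (intro Set.equalityI subsetI)
  fix t assume "t \<in> ?L"
  then obtain i where i: "k \<le> i" "{B. t B \<noteq> 0} \<in> Del_plus A r i"
    and nonneg: "\<And>B. 0 \<le> t B" and total: "sum t {B. t B \<noteq> 0} = 1"
    by (auto simp: realization_def S_Del_def)
  have sub: "\<And>B. t B \<noteq> 0 \<Longrightarrow> B \<subseteq> A" and card: "\<And>B. t B \<noteq> 0 \<Longrightarrow> card B = i \<or> card B = Suc i"
    using i(2) by (auto simp: Del_plus_def)
  have "sum t (Pow A) = sum t {B. t B \<noteq> 0}"
    using fin sub by (intro sum.mono_neutral_right) auto
  then have total': "sum t (Pow A) = 1" using total by simp
  note between = sum_mean_between[OF fin nonneg total' card]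
  have "mean A t \<in> del_weights A r k"
    using mean_in_cube[OF fin nonneg total'] between(1) i k
      Del_plus_imp_spherical[OF fin nonneg total' _ i(2)] by (simp add: del_weights_def)
  then show "t \<in> ?R" using nonneg sub total' between(2) by blast
next
  fix t assume "t \<in> ?R"
  then have nonneg: "\<And>B. 0 \<le> t B" and total: "sum t (Pow A) = 1"
    and sub: "\<And>B. t B \<noteq> 0 \<Longrightarrow> B \<subseteq> A"
    and level: "\<And>B. t B \<noteq> 0 \<Longrightarrow> near_level (sum (mean A t) A) (card B)"
    and P: "mean A t \<in> del_weights A r k" by auto
  from P obtain c \<rho> where c: "0 \<le> \<rho>" "\<rho> \<le> r" "spherical A (mean A t) c \<rho>" "real k \<le> sum (mean A t) A"
    by (auto simp: del_weights_def)
  have eq: "sum t (Pow A) = sum t {B. t B \<noteq> 0}"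
    using fin sub by (intro sum.mono_neutral_right) auto
  \<comment> \<open>The floor of the mean size picks the layer; the integer bound \<open>k\<close>
    passes from the mean size to its floor.\<close>
  define i where "i = nat \<lfloor>sum (mean A t) A\<rfloor>"
  have i: "int i = \<lfloor>sum (mean A t) A\<rfloor>" "k \<le> i"
    using c(4) unfolding i_def by (auto simp: le_nat_floor)
  have near: "dist c a \<le> \<rho>" if "t B \<noteq> 0" "a \<in> B" for a B
    using c(3) mean_pos[OF fin nonneg total sub[OF that(1)] that] sub[OF that(1)] that(2)
    by (auto simp: spherical_def)
  have far: "\<rho> \<le> dist c a" if "t B \<noteq> 0" "a \<in> A" "a \<notin> B" for a B
    using c(3) mean_less_1[OF fin nonneg total sub[OF that(1)] that(1,3)] that(2)
    by (auto simp: spherical_def)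
  have "c \<in> Ball_r r B \<inter> Vor A B" if "t B \<noteq> 0" for B
    using near[OF that] far[OF that] c(2)
    by (force simp: Ball_r_def Vor_def simp flip: dist_norm)
  then have "c \<in> (\<Inter>B\<in>{B. t B \<noteq> 0}. Ball_r r B \<inter> Vor A B)" by blast
  moreover have "B \<subseteq> A \<and> (card B = i \<or> card B = i + 1)" if "t B \<noteq> 0" for B
    using sub[OF that] level[OF that] i(1) unfolding near_level_def by linarith
  moreover have "{B. t B \<noteq> 0} \<noteq> {}" using total eq by (metis sum.empty zero_neq_one)
  moreover have "finite {B. t B \<noteq> 0}" using fin sub by (auto intro: finite_subset[of _ "Pow A"])
  ultimately have "{B. t B \<noteq> 0} \<in> Del_plus A r i"
    unfolding Del_plus_def by blast
  then show "t \<in> ?L" using nonneg total eq i(2) by (auto simp: realization_def S_Del_def)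
qed

section \<open>Weights and spheres\<close>

definition lifted :: "'a::euclidean_space set \<Rightarrow> ('a \<Rightarrow> real) \<Rightarrow> 'a \<times> real" where
  "lifted A l = (\<Sum>a\<in>A. l a *\<^sub>R a, - sum l A)"

text \<open>Exhibits \<open>mean A\<close> followed by \<open>lifted A\<close> as the affine
  extension of \<open>embed_vertex\<close> to probability vectors.\<close>

lemma lifted_mean:
  assumes "finite A"
  shows "lifted A (mean A t) = (\<Sum>B\<in>Pow A. t B *\<^sub>R embed_vertex B)"
  using sum_mean_scaleR[OF assms, of t "\<lambda>a. a"] sum_mean[OF assms, of t]
  by (simp add: lifted_def embed_vertex_def prod_eq_iff fst_sum snd_sum sum_negf)

text \<open>General position allows at most \<open>DIM('a) + 1\<close> sites on a sphere of positive
  radius, and so few sites are affinely independent. A sphere of radius 0 is a point.\<close>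

lemma on_sphere_independent:
  fixes A :: "'a::euclidean_space set"
  assumes "general_position A" "finite A" "0 \<le> \<rho>"
  shows "\<not> affine_dependent (A_on A c \<rho>)"
proof (cases "\<rho> = 0")
  case True
  then have "A_on A c \<rho> = {} \<or> A_on A c \<rho> = {c}" by (auto simp: A_on_def)
  then show ?thesis by auto
next
  case False
  have sub: "A_on A c \<rho> \<subseteq> A" by (auto simp: A_on_def)
  have "card (A_on A c \<rho>) \<le> DIM('a) + 1"
  proof (rule ccontr)
    assume "\<not> card (A_on A c \<rho>) \<le> DIM('a) + 1"
    then have "DIM('a) + 2 \<le> card (A_on A c \<rho>)" by simp
    then obtain B where B: "B \<subseteq> A_on A c \<rho>" "card B = DIM('a) + 2"
      by (rule obtain_subset_with_card_n)
    then have "B \<subseteq> sphere c \<rho>" "B \<subseteq> A" by (auto simp: A_on_def)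
    moreover have "0 < \<rho>" using assms(3) False by simp
    ultimately show False
      using assms(1) B(2) unfolding general_position_def by blast
  qed
  then show ?thesis using assms(1) sub by (auto simp: general_position_def)
qed

text \<open>The weights of a point of the rhomboid tiling are the solution of the linear program that
  minimises \<open>\<Sum>a. l a * (dist c a\<^sup>2 - \<rho>\<^sup>2)\<close> over its fibre in the cube. Two spheres
  change the objective only by a functional of the lifted point, so optimality for both confines
  the difference of two solutions to sites on the sphere.\<close>

lemma lifted_inj:
  fixes A :: "'a::euclidean_space set"
  assumes gp: "general_position A" "finite A"
    and l: "l \<in> cube A" "spherical A l c \<rho>" "0 \<le> \<rho>"
    and m: "m \<in> cube A" "spherical A m c' \<rho>'" "0 \<le> \<rho>'"
    and eq: "lifted A l = lifted A m"
  shows "l = m"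
proof -
  define d where "d a = l a - m a" for a
  define p where "p a = (dist c a)\<^sup>2 - \<rho>\<^sup>2" for a
  define q where "q a = (dist c' a)\<^sup>2 - \<rho>'\<^sup>2" for a
  have d1: "(\<Sum>a\<in>A. d a *\<^sub>R a) = 0" and d0: "sum d A = 0"
    using eq by (simp_all add: lifted_def d_def scaleR_diff_left sum_subtractf)
  have pq: "p a - q a = (norm c)\<^sup>2 - \<rho>\<^sup>2 - (norm c')\<^sup>2 + \<rho>'\<^sup>2 + 2 * ((c' - c) \<bullet> a)" for a
    by (simp add: p_def q_def dist_norm power2_norm_eq_inner inner_diff inner_commute algebra_simps)
  have "(\<Sum>a\<in>A. d a * (p a - q a))
      = ((norm c)\<^sup>2 - \<rho>\<^sup>2 - (norm c')\<^sup>2 + \<rho>'\<^sup>2) * sum d A + 2 * ((c' - c) \<bullet> (\<Sum>a\<in>A. d a *\<^sub>R a))"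
    by (simp add: pq inner_sum_right sum_distrib_left sum_distrib_right distrib_left sum.distrib ac_simps)
  then have sum0: "(\<Sum>a\<in>A. d a * (p a - q a)) = 0" using d0 d1 by simp
  \<comment> \<open>A site off the first sphere has \<open>l a\<close> extreme, 1 inside and 0
    outside, while \<open>m a\<close> lies in \<open>[0, 1]\<close>; so \<open>d a\<close> and
    \<open>p a\<close> never have the same strict sign. For \<open>q\<close> the roles of
    \<open>l\<close> and \<open>m\<close> are exchanged.\<close>
  have dp: "d a * p a \<le> 0" if "a \<in> A" for a
  proof -
    have "0 \<le> l a" "l a \<le> 1" "0 \<le> m a" "m a \<le> 1" using l m that by (auto simp: cube_def)
    moreover have "p a \<ge> 0" if "l a < 1"
      using that \<open>a \<in> A\<close> l by (auto simp: p_def spherical_def intro!: power_mono)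
    moreover have "p a \<le> 0" if "l a > 0"
      using that \<open>a \<in> A\<close> l by (auto simp: p_def spherical_def intro!: power_mono)
    ultimately show ?thesis
      unfolding d_def mult_le_0_iff by (cases "l a > 0"; cases "l a < 1") auto
  qed
  have dq: "0 \<le> d a * q a" if "a \<in> A" for a
  proof -
    have "0 \<le> l a" "l a \<le> 1" "0 \<le> m a" "m a \<le> 1" using l m that by (auto simp: cube_def)
    moreover have "q a \<ge> 0" if "m a < 1"
      using that \<open>a \<in> A\<close> m by (auto simp: q_def spherical_def intro!: power_mono)
    moreover have "q a \<le> 0" if "m a > 0"
      using that \<open>a \<in> A\<close> m by (auto simp: q_def spherical_def intro!: power_mono)
    ultimately show ?thesis
      unfolding d_def zero_le_mult_iff by (cases "m a > 0"; cases "m a < 1") auto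
  qed
  \<comment> \<open>Nonnegative summands with sum 0 all vanish; as \<open>d a * p a\<close> and
    \<open>d a * q a\<close> have opposite signs, each then vanishes by itself.\<close>
  have "\<forall>a\<in>A. d a * (q a - p a) = 0"
  proof (subst sum_nonneg_eq_0_iff[symmetric])
    show "(\<Sum>a\<in>A. d a * (q a - p a)) = 0"
      using sum0 by (simp add: right_diff_distrib sum_subtractf)
  qed (use dp dq gp in \<open>fastforce simp: right_diff_distrib\<close>)+
  then have "d a = 0 \<or> p a = 0" if "a \<in> A" for a
    using dp[OF that] dq[OF that] that by (force simp: right_diff_distrib)
  then have supp: "d a = 0" if "a \<in> A - A_on A c \<rho>" for a
    using that l(3) by (auto simp: p_def A_on_def)
  have on: "finite (A_on A c \<rho>)" "A_on A c \<rho> \<subseteq> A" using gp by (auto simp: A_on_def)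
  have "sum d (A_on A c \<rho>) = sum d A"
    using on(2) supp gp(2) by (intro sum.mono_neutral_left) auto
  moreover have "(\<Sum>a\<in>A_on A c \<rho>. d a *\<^sub>R a) = (\<Sum>a\<in>A. d a *\<^sub>R a)"
    using on(2) supp gp(2) by (intro sum.mono_neutral_left) auto
  \<comment> \<open>The differences \<open>d\<close> are now an affine relation among sites on one
    sphere, trivial by affine independence.\<close>
  ultimately have "sum d (A_on A c \<rho>) = 0" "(\<Sum>a\<in>A_on A c \<rho>. d a *\<^sub>R a) = 0"
    using d0 d1 by simp_all
  then have "\<forall>a\<in>A_on A c \<rho>. d a = 0"
    using on_sphere_independent[OF gp l(3), of c] affine_dependent_explicit_finite[OF on(1)] by blast
  then have "l a = m a" if "a \<in> A" for a
    using supp that by (auto simp: d_def)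
  moreover have "l a = m a" if "a \<notin> A" for a
    using l(1) m(1) that by (simp add: cube_def)
  ultimately show ?thesis by blast
qed

text \<open>With one point of \<open>Q\<close> moved to the origin the others are linearly
  independent, so a linear functional with the required differences exists; \<open>v\<close>
  represents it.\<close>

lemma affine_interpolation:
  fixes Q :: "'a::euclidean_space set"
  assumes "\<not> affine_dependent Q"
  obtains v \<tau> where "\<And>a. a \<in> Q \<Longrightarrow> v \<bullet> a + \<tau> = (f a :: real)"
proof (cases "Q = {}")
  case False
  then obtain a0 where a0: "a0 \<in> Q" by auto
  with assms have "independent ((\<lambda>x. - a0 + x) ` (Q - {a0}))"
    by (simp add: affine_dependent_iff_dependent2)
  then obtain g :: "'a \<Rightarrow> real" where g: "linear g"
      "\<And>y. y \<in> (\<lambda>x. - a0 + x) ` (Q - {a0}) \<Longrightarrow> g y = f (a0 + y) - f a0"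
    using linear_independent_extend[of _ "\<lambda>y. f (a0 + y) - f a0"] by blast
  define v where "v = adjoint g 1"
  have gv: "g y = v \<bullet> y" for y
    using adjoint_works[OF g(1), of y 1] by (simp add: v_def inner_commute)
  have "v \<bullet> a + (f a0 - v \<bullet> a0) = f a" if "a \<in> Q" for a
  proof (cases "a = a0")
    case False
    then have "g (- a0 + a) = f (a0 + (- a0 + a)) - f a0" using that by (intro g(2)) auto
    then show ?thesis by (simp add: gv inner_diff_right)
  qed simp
  then show thesis by (rule that)
qed (use that in auto)

text \<open>Affine independence of the sites on the sphere lets a small move push those of weight 1
  inside and those of weight 0 outside while keeping the fractional ones on it; sites off the sphere
  stay on their side. This produces the smallest rhomboid around a point.\<close>

lemma spherical_perturb:
  fixes A :: "'a::euclidean_space set"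
  assumes gp: "general_position A" "finite A"
    and l: "l \<in> cube A" "spherical A l c \<rho>" "0 \<le> \<rho>" "1 \<le> sum l A"
    and \<epsilon>: "0 < \<epsilon>"
  shows "\<exists>c' \<rho>'. 0 < \<rho>' \<and> \<rho>' < \<rho> + \<epsilon> \<and>
    A_in A c' \<rho>' = {a \<in> A. l a = 1} \<and> A_on A c' \<rho>' = {a \<in> A. 0 < l a \<and> l a < 1}"
proof -
  define sg :: "'a \<Rightarrow> real" where "sg a = (if l a = 1 then 1 else if l a = 0 then -1 else 0)" for a
  obtain v \<tau> where v: "\<And>a. a \<in> A_on A c \<rho> \<Longrightarrow> v \<bullet> a + \<tau> = sg a"
    using affine_interpolation[OF on_sphere_independent[OF gp l(3)]] by metis
  \<comment> \<open>The squared radius is chosen so that terms quadratic in \<open>\<eta>\<close>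
    cancel: the power of a site changes by \<open>- 2 * \<eta> * (v \<bullet> a + \<tau>)\<close>,
    which is \<open>- 2 * \<eta> * sg a\<close> on the old sphere.\<close>
  define q where "q \<eta> = \<rho>\<^sup>2 + 2 * \<eta> * (\<tau> + c \<bullet> v) + \<eta>\<^sup>2 * (v \<bullet> v)" for \<eta>
  have pw: "(dist (c + \<eta> *\<^sub>R v) a)\<^sup>2 - q \<eta> = (dist c a)\<^sup>2 - \<rho>\<^sup>2 - 2 * \<eta> * (v \<bullet> a + \<tau>)" for \<eta> a
    unfolding q_def dist_norm power2_norm_eq_inner
    by (simp add: inner_diff inner_add inner_commute algebra_simps power2_eq_square)
  have bnd: "0 \<le> l a" "l a \<le> 1" if "a \<in> A" for a using l that by (auto simp: cube_def)
  have in1: "l a = 1" if "a \<in> A" "dist c a < \<rho>" for a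
    using l(2) that bnd[of a] by (force simp: spherical_def)
  have out0: "l a = 0" if "a \<in> A" "\<rho> < dist c a" for a
    using l(2) that bnd[of a] by (force simp: spherical_def)
  have cont: "((\<lambda>\<eta>. x - 2 * \<eta> * y) \<longlongrightarrow> x) (at_right 0)" for x y :: real
    by (auto intro!: tendsto_eq_intros)
  have q0: "(q \<longlongrightarrow> \<rho>\<^sup>2) (at_right 0)"
    unfolding q_def by (auto intro!: tendsto_eq_intros)
  have "\<rho>\<^sup>2 < (\<rho> + \<epsilon>)\<^sup>2" using l(3) \<epsilon> by (intro power_strict_mono) auto
  then have "\<forall>\<^sub>F \<eta> in at_right 0. q \<eta> < (\<rho> + \<epsilon>)\<^sup>2"
    using q0 order_tendstoD(2) by blast
  moreover have "\<forall>\<^sub>F \<eta> in at_right 0. 0 < \<rho> \<longrightarrow> 0 < q \<eta>"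
    using order_tendstoD(1)[OF q0, of 0] by (cases "0 < \<rho>") auto
  moreover have "\<forall>\<^sub>F \<eta> in at_right 0. \<forall>a\<in>A. dist c a < \<rho> \<longrightarrow>
      (dist c a)\<^sup>2 - \<rho>\<^sup>2 - 2 * \<eta> * (v \<bullet> a + \<tau>) < 0"
  proof (intro eventually_ball_finite gp ballI)
    fix a
    show "\<forall>\<^sub>F \<eta> in at_right 0. dist c a < \<rho> \<longrightarrow> (dist c a)\<^sup>2 - \<rho>\<^sup>2 - 2 * \<eta> * (v \<bullet> a + \<tau>) < 0"
    proof (cases "dist c a < \<rho>")
      case True
      then have "(dist c a)\<^sup>2 - \<rho>\<^sup>2 < 0" by (simp add: power_strict_mono)
      from order_tendstoD(2)[OF cont[of _ "v \<bullet> a + \<tau>"] this] show ?thesis by (rule eventually_mono) simp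
    qed simp
  qed
  moreover have "\<forall>\<^sub>F \<eta> in at_right 0. \<forall>a\<in>A. \<rho> < dist c a \<longrightarrow>
      0 < (dist c a)\<^sup>2 - \<rho>\<^sup>2 - 2 * \<eta> * (v \<bullet> a + \<tau>)"
  proof (intro eventually_ball_finite gp ballI)
    fix a
    show "\<forall>\<^sub>F \<eta> in at_right 0. \<rho> < dist c a \<longrightarrow> 0 < (dist c a)\<^sup>2 - \<rho>\<^sup>2 - 2 * \<eta> * (v \<bullet> a + \<tau>)"
    proof (cases "\<rho> < dist c a")
      case True
      then have "0 < (dist c a)\<^sup>2 - \<rho>\<^sup>2" using l(3) by (simp add: power_strict_mono)
      from order_tendstoD(1)[OF cont[of _ "v \<bullet> a + \<tau>"] this] show ?thesis by (rule eventually_mono) simp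
    qed simp
  qed
  moreover have "\<forall>\<^sub>F \<eta>::real in at_right 0. 0 < \<eta>"
    by (simp add: eventually_at_right_less)
  ultimately have "\<forall>\<^sub>F \<eta> in at_right 0. q \<eta> < (\<rho> + \<epsilon>)\<^sup>2 \<and> (0 < \<rho> \<longrightarrow> 0 < q \<eta>) \<and>
      (\<forall>a\<in>A. dist c a < \<rho> \<longrightarrow> (dist c a)\<^sup>2 - \<rho>\<^sup>2 - 2 * \<eta> * (v \<bullet> a + \<tau>) < 0) \<and>
      (\<forall>a\<in>A. \<rho> < dist c a \<longrightarrow> 0 < (dist c a)\<^sup>2 - \<rho>\<^sup>2 - 2 * \<eta> * (v \<bullet> a + \<tau>)) \<and> 0 < \<eta>"
    by eventually_elim simp
  then obtain \<eta> where \<eta>: "q \<eta> < (\<rho> + \<epsilon>)\<^sup>2" "0 < \<rho> \<longrightarrow> 0 < q \<eta>"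
      "\<And>a. a \<in> A \<Longrightarrow> dist c a < \<rho> \<Longrightarrow> (dist (c + \<eta> *\<^sub>R v) a)\<^sup>2 < q \<eta>"
      "\<And>a. a \<in> A \<Longrightarrow> \<rho> < dist c a \<Longrightarrow> q \<eta> < (dist (c + \<eta> *\<^sub>R v) a)\<^sup>2" "0 < \<eta>"
    using eventually_happens'[OF trivial_limit_at_right_real] unfolding pw[symmetric]
    by (metis (no_types, lifting) diff_gt_0_iff_gt diff_less_0_iff_less)
  let ?c = "c + \<eta> *\<^sub>R v"
  have on: "(dist ?c a)\<^sup>2 - q \<eta> = - 2 * \<eta> * sg a" if "a \<in> A" "dist c a = \<rho>" for a
    using pw[of \<eta> a] v[of a] that by (simp add: A_on_def)
  have trich: "((dist ?c a)\<^sup>2 < q \<eta> \<longleftrightarrow> l a = 1) \<and> ((dist ?c a)\<^sup>2 = q \<eta> \<longleftrightarrow> 0 < l a \<and> l a < 1)"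
    if a: "a \<in> A" for a
  proof -
    consider "dist c a < \<rho>" | "\<rho> < dist c a" | "dist c a = \<rho>" by linarith
    then show ?thesis
    proof cases
      case 1
      then show ?thesis using in1[OF a] \<eta>(3)[OF a] by auto
    next
      case 2
      then show ?thesis using out0[OF a] \<eta>(4)[OF a] by auto
    next
      case 3
      from on[OF a 3] show ?thesis
        using \<open>0 < \<eta>\<close> bnd[OF a] by (auto simp: sg_def split: if_splits)
    qed
  qed
  \<comment> \<open>If \<open>\<rho> = 0\<close>, every site other than the centre has weight 0, so
    a total of at least 1 makes the centre a site of weight 1. It lies strictly inside the moved
    sphere, whose squared radius is therefore positive.\<close>
  have "0 < q \<eta>"
  proof (cases "0 < \<rho>")
    case False
    then have "\<rho> = 0" using l(3) by simp
    then have "l a = 0" if "a \<in> A - {c}" for a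
      using out0[of a] that by auto
    then have "sum l A = sum l (A \<inter> {c})"
      using gp by (intro sum.mono_neutral_right) auto
    with l(4) have "c \<in> A \<and> l c \<ge> 1" by (cases "c \<in> A") auto
    then have "(dist ?c c)\<^sup>2 < q \<eta>" using trich[of c] bnd[of c] by auto
    then show ?thesis by (meson order_le_less_trans zero_le_power2)
  qed (use \<eta>(2) in simp)
  have sq: "dist ?c a < sqrt (q \<eta>) \<longleftrightarrow> (dist ?c a)\<^sup>2 < q \<eta>"
    "dist ?c a = sqrt (q \<eta>) \<longleftrightarrow> (dist ?c a)\<^sup>2 = q \<eta>" for a
    using real_sqrt_less_iff[of "(dist ?c a)\<^sup>2" "q \<eta>"] real_sqrt_eq_iff[of "(dist ?c a)\<^sup>2" "q \<eta>"] by simp_all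
  have "sqrt (q \<eta>) < \<rho> + \<epsilon>"
    using \<eta>(1) l(3) \<epsilon> real_sqrt_less_iff[of "q \<eta>" "(\<rho> + \<epsilon>)\<^sup>2"] by simp
  then show ?thesis
    using \<open>0 < q \<eta>\<close> trich
    by (intro exI[of _ ?c] exI[of _ "sqrt (q \<eta>)"]) (auto simp: A_in_def A_on_def sq)
qed

section \<open>The sliced rhomboid tiling\<close>

text \<open>A product, over the whole index type, of closed subsets of the unit interval; compact by
  Tychonoff.\<close>

lemma compact_cube_face: "compact {l \<in> cube A. (\<forall>a\<in>I. l a = 1) \<and> (\<forall>a\<in>J. l a = 0)}"
proof -
  let ?S = "\<lambda>a. {x::real. 0 \<le> x \<and> x \<le> 1 \<and> (a \<in> I \<longrightarrow> x = 1) \<and> (a \<in> J \<longrightarrow> x = 0) \<and> (a \<notin> A \<longrightarrow> x = 0)}"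
  have "compact (?S a)" for a
  proof -
    have "?S a = {0..1} \<inter> (if a \<in> I then {1} else UNIV) \<inter> (if a \<in> J then {0} else UNIV)
        \<inter> (if a \<notin> A then {0} else UNIV)"
      by auto
    then show ?thesis by (auto intro!: compact_Int_closed)
  qed
  then have "compact (PiE UNIV ?S)"
    using compactin_PiE[of "\<lambda>_. euclidean" UNIV ?S] by (simp add: euclidean_product_topology)
  moreover have "PiE UNIV ?S = {l \<in> cube A. (\<forall>a\<in>I. l a = 1) \<and> (\<forall>a\<in>J. l a = 0)}"
  proof (intro Set.equalityI subsetI)
    fix l assume "l \<in> PiE UNIV ?S"
    then have "l a \<in> ?S a" for a by (rule PiE_mem) simp
    then show "l \<in> {l \<in> cube A. (\<forall>a\<in>I. l a = 1) \<and> (\<forall>a\<in>J. l a = 0)}"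
      by (simp add: cube_def)
  next
    fix l :: "'a \<Rightarrow> real" assume l: "l \<in> {l \<in> cube A. (\<forall>a\<in>I. l a = 1) \<and> (\<forall>a\<in>J. l a = 0)}"
    have "l a \<in> ?S a" for a
    proof -
      have "0 \<le> l a \<and> l a \<le> 1" using l by (cases "a \<in> A") (simp_all add: cube_def)
      moreover have "(a \<in> I \<longrightarrow> l a = 1) \<and> (a \<in> J \<longrightarrow> l a = 0) \<and> (a \<notin> A \<longrightarrow> l a = 0)"
        using l unfolding cube_def by blast
      ultimately show ?thesis by simp
    qed
    then show "l \<in> PiE UNIV ?S" by (intro PiE_I) auto
  qed
  ultimately show ?thesis by simp
qed

lemma spherical_iff:
  assumes "l \<in> cube A"
  shows "spherical A l c \<rho> \<longleftrightarrow> (\<forall>a\<in>A_in A c \<rho>. l a = 1) \<and> (\<forall>a\<in>{a \<in> A. \<rho> < dist c a}. l a = 0)"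
  using assms unfolding spherical_def cube_def A_in_def
  by (auto simp: not_less) (smt (verit))+

text \<open>Infinitely many spheres induce only finitely many pairs of inside and outside sites, so
  this is a finite union of cube faces. Compactness later makes the inverse of
  \<open>lifted A\<close> continuous.\<close>

lemma compact_spherical:
  fixes A :: "'a::euclidean_space set"
  assumes "finite A"
  shows "compact {l \<in> cube A. \<exists>c \<rho>. 0 \<le> \<rho> \<and> spherical A l c \<rho>}"
proof -
  let ?face = "\<lambda>(I, J). {l \<in> cube A. (\<forall>a\<in>I. l a = (1::real)) \<and> (\<forall>a\<in>J. l a = 0)}"
  let ?IJ = "{(A_in A c \<rho>, {a \<in> A. \<rho> < dist c a}) | c \<rho>. 0 \<le> \<rho>}"
  have "{l \<in> cube A. \<exists>c \<rho>. 0 \<le> \<rho> \<and> spherical A l c \<rho>} = (\<Union>IJ\<in>?IJ. ?face IJ)"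
  proof (intro Set.equalityI subsetI)
    fix l assume "l \<in> {l \<in> cube A. \<exists>c \<rho>. 0 \<le> \<rho> \<and> spherical A l c \<rho>}"
    then obtain c \<rho> where "l \<in> cube A" "0 \<le> \<rho>" "spherical A l c \<rho>" by blast
    then have "l \<in> ?face (A_in A c \<rho>, {a \<in> A. \<rho> < dist c a})"
      by (simp add: spherical_iff)
    then show "l \<in> (\<Union>IJ\<in>?IJ. ?face IJ)" using \<open>0 \<le> \<rho>\<close> by blast
  next
    fix l assume "l \<in> (\<Union>IJ\<in>?IJ. ?face IJ)"
    then obtain c \<rho> where "0 \<le> \<rho>" "l \<in> ?face (A_in A c \<rho>, {a \<in> A. \<rho> < dist c a})" by blast
    then show "l \<in> {l \<in> cube A. \<exists>c \<rho>. 0 \<le> \<rho> \<and> spherical A l c \<rho>}"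
      using spherical_iff[of l A c \<rho>] by auto
  qed
  moreover have "finite ?IJ"
    by (rule finite_subset[of _ "Pow A \<times> Pow A"]) (use assms in \<open>auto simp: A_in_def\<close>)
  moreover have "compact (?face IJ)" for IJ
    using compact_cube_face by (cases IJ) auto
  ultimately show ?thesis by (metis (no_types, lifting) compact_UN)
qed

text \<open>Rhomboid radii are infima, so a sphere of radius at most \<open>r\<close> has to come
  from a limit. A site of positive weight lies in every admissible ball, which bounds the centres,
  and the conditions on centre and radius are closed.\<close>

lemma spherical_limit:
  fixes A :: "'a::euclidean_space set"
  assumes "a0 \<in> A" "0 < l a0"
    and approx: "\<And>\<epsilon>. 0 < \<epsilon> \<Longrightarrow> \<exists>c \<rho>. 0 \<le> \<rho> \<and> \<rho> \<le> r + \<epsilon> \<and> spherical A l c \<rho>"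
  shows "\<exists>c \<rho>. 0 \<le> \<rho> \<and> \<rho> \<le> r \<and> spherical A l c \<rho>"
proof -
  define K where "K = {p :: 'a \<times> real. 0 \<le> snd p \<and> snd p \<le> r + 1 \<and> spherical A l (fst p) (snd p)}"
  have "K = {p. 0 \<le> snd p} \<inter> {p. snd p \<le> r + 1} \<inter>
      (\<Inter>a\<in>{a \<in> A. l a < 1}. {p. snd p \<le> dist (fst p) a}) \<inter>
      (\<Inter>a\<in>{a \<in> A. 0 < l a}. {p. dist (fst p) a \<le> snd p})"
    by (auto simp: K_def spherical_def)
  moreover have "closed \<dots>"
    by (intro closed_Int closed_INT ballI closed_Collect_le continuous_intros)
  ultimately have "closed K" by simp
  moreover have "K \<subseteq> cball a0 (r + 1) \<times> {0..r + 1}"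
    using assms(1,2) by (force simp: K_def spherical_def dist_commute)
  ultimately have "compact K"
    using bounded_subset[OF bounded_Times[OF bounded_cball bounded_closed_interval]]
    unfolding compact_eq_bounded_closed by blast
  moreover have "K \<noteq> {}"
    using approx[of 1] by (auto simp: K_def)
  moreover have "continuous_on K snd" by (intro continuous_intros)
  ultimately obtain p where p: "p \<in> K" "\<And>p'. p' \<in> K \<Longrightarrow> snd p \<le> snd p'"
    using continuous_attains_inf[of K snd] by blast
  have "snd p \<le> r + \<epsilon>" if "0 < \<epsilon>" for \<epsilon>
  proof -
    \<comment> \<open>Capping at 1 keeps the approximating sphere in the compact set
      \<open>K\<close>.\<close>
    have "0 < min \<epsilon> 1" using that by simp
    from approx[OF this] obtain c \<rho>
      where c: "0 \<le> \<rho>" "\<rho> \<le> r + min \<epsilon> 1" "spherical A l c \<rho>" by blast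
    then have "(c, \<rho>) \<in> K" by (auto simp: K_def)
    from p(2)[OF this] c(2) show ?thesis by simp
  qed
  then have "snd p \<le> r" by (rule field_le_epsilon)
  with p(1) show ?thesis by (auto simp: K_def)
qed

text \<open>Vertices correspond to indicator weights and admissible weights are convex, which gives
  one inclusion. For the other, systematic sampling writes \<open>l\<close> as a mean of sets
  between \<open>{a \<in> A. l a = 1}\<close> and \<open>{a \<in> A. 0 < l a}\<close>, and these are
  vertices of the rhomboid.\<close>

lemma geom_comb_rhomboid:
  fixes A :: "'a::euclidean_space set"
  assumes "finite A"
  shows "geom_rhomboid (comb_rhomboid A c \<rho>) = lifted A ` {l \<in> cube A. spherical A l c \<rho>}"
proof (rule Set.equalityI)
  show "geom_rhomboid (comb_rhomboid A c \<rho>) \<subseteq> lifted A ` {l \<in> cube A. spherical A l c \<rho>}"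
    unfolding geom_rhomboid_def
  proof (rule hull_minimal)
    show "embed_vertex ` comb_rhomboid A c \<rho> \<subseteq> lifted A ` {l \<in> cube A. spherical A l c \<rho>}"
    proof (rule image_subsetI)
      fix v assume "v \<in> comb_rhomboid A c \<rho>"
      then obtain Q where Q: "v = A_in A c \<rho> \<union> Q" "Q \<subseteq> A_on A c \<rho>" by (auto simp: comb_rhomboid_def)
      then have v: "v \<subseteq> A" by (auto simp: A_in_def A_on_def)
      define l :: "'a \<Rightarrow> real" where "l = indicator v"
      have "(\<Sum>a\<in>A. l a *\<^sub>R a) = (\<Sum>a\<in>v. a)" "sum l A = (\<Sum>a\<in>v. 1)"
        using assms v by (intro sum.mono_neutral_cong_right; simp add: l_def)+
      then have "embed_vertex v = lifted A l"
        by (simp add: embed_vertex_def lifted_def)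
      moreover have "l \<in> cube A" using v by (auto simp: l_def cube_def indicator_def)
      moreover have "spherical A l c \<rho>"
        using Q by (auto simp: spherical_def l_def A_in_def A_on_def indicator_def not_less)
      ultimately show "embed_vertex v \<in> lifted A ` {l \<in> cube A. spherical A l c \<rho>}" by blast
    qed
    show "convex (lifted A ` {l \<in> cube A. spherical A l c \<rho>})"
    proof (rule convexI)
      fix x y and u w :: real
      assume uw: "0 \<le> u" "0 \<le> w" "u + w = 1"
        and "x \<in> lifted A ` {l \<in> cube A. spherical A l c \<rho>}"
        and "y \<in> lifted A ` {l \<in> cube A. spherical A l c \<rho>}"
      then obtain l m where l: "x = lifted A l" "l \<in> cube A" "spherical A l c \<rho>"
        and m: "y = lifted A m" "m \<in> cube A" "spherical A m c \<rho>" by auto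
      define k where "k a = u * l a + w * m a" for a
      have k: "u *\<^sub>R x + w *\<^sub>R y = lifted A k"
        by (simp add: l(1) m(1) lifted_def k_def scaleR_sum_right scaleR_add_left sum.distrib sum_distrib_left)
      have kc: "k \<in> cube A"
        using l(2) m(2) uw convex_bound_le[of _ 1 _ u w]
        by (auto simp: cube_def k_def)
      have "spherical A k c \<rho>"
        unfolding spherical_iff[OF kc]
        using l(3) m(3) uw(3) by (auto simp: spherical_iff[OF l(2)] spherical_iff[OF m(2)] k_def)
      with k kc show "u *\<^sub>R x + w *\<^sub>R y \<in> lifted A ` {l \<in> cube A. spherical A l c \<rho>}" by blast
    qed
  qed
  show "lifted A ` {l \<in> cube A. spherical A l c \<rho>} \<subseteq> geom_rhomboid (comb_rhomboid A c \<rho>)"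
  proof (rule image_subsetI)
    fix l assume "l \<in> {l \<in> cube A. spherical A l c \<rho>}"
    then have l: "l \<in> cube A" "spherical A l c \<rho>" by auto
    obtain g :: "('a \<Rightarrow> real) \<Rightarrow> 'a set \<Rightarrow> real" where g:
        "continuous_on UNIV g"
        "\<And>l B. 0 \<le> g l B"
        "\<And>l B. g l B \<noteq> 0 \<Longrightarrow> B \<subseteq> A"
        "\<And>l. sum (g l) (Pow A) = 1"
        "\<And>l. l \<in> cube A \<Longrightarrow> mean A (g l) = l"
        "\<And>l B. l \<in> cube A \<Longrightarrow> g l B \<noteq> 0 \<Longrightarrow>
          {a \<in> A. l a = 1} \<subseteq> B \<and> B \<subseteq> {a \<in> A. 0 < l a} \<and> near_level (sum l A) (card B)"
      by (fact sampling[OF assms])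
    let ?S = "{B \<in> Pow A. g l B \<noteq> 0}"
    have "?S \<subseteq> comb_rhomboid A c \<rho>"
    proof clarify
      fix B assume B: "B \<subseteq> A" "g l B \<noteq> 0"
      then have one: "{a \<in> A. l a = 1} \<subseteq> B" and pos: "B \<subseteq> {a \<in> A. 0 < l a}"
        using g(6)[OF l(1)] by blast+
      have "A_in A c \<rho> \<subseteq> {a \<in> A. l a = 1}"
        using l(2) unfolding spherical_iff[OF l(1)] by (auto simp: A_in_def)
      moreover have "{a \<in> A. 0 < l a} \<subseteq> A_in A c \<rho> \<union> A_on A c \<rho>"
        using l(2) by (auto simp: spherical_def A_in_def A_on_def le_less)
      ultimately have "A_in A c \<rho> \<subseteq> B" "B \<subseteq> A_in A c \<rho> \<union> A_on A c \<rho>"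
        using one pos by blast+
      then show "B \<in> comb_rhomboid A c \<rho>"
        unfolding comb_rhomboid_def by (intro CollectI exI[of _ "B \<inter> A_on A c \<rho>"]) auto
    qed
    then have hull: "embed_vertex B \<in> geom_rhomboid (comb_rhomboid A c \<rho>)" if "B \<in> ?S" for B
      using that unfolding geom_rhomboid_def by (intro hull_inc imageI) auto
    have "lifted A l = (\<Sum>B\<in>Pow A. g l B *\<^sub>R embed_vertex B)"
      using lifted_mean[OF assms, of "g l"] g(5)[OF l(1)] by simp
    also have "\<dots> = (\<Sum>B\<in>?S. g l B *\<^sub>R embed_vertex B)"
      using assms by (intro sum.mono_neutral_right) auto
    also have "\<dots> \<in> geom_rhomboid (comb_rhomboid A c \<rho>)"
    proof (rule convex_sum)
      have "sum (g l) ?S = sum (g l) (Pow A)"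
        using assms by (intro sum.mono_neutral_left) auto
      then show "sum (g l) ?S = 1" using g(4) by simp
    qed (use assms g(2) hull in \<open>auto simp: geom_rhomboid_def\<close>)
    finally show "lifted A l \<in> geom_rhomboid (comb_rhomboid A c \<rho>)" .
  qed
qed

section \<open>Finiteness, compactness, depths and radii of cells\<close>

lemma finite_rhomboids: "finite A \<Longrightarrow> finite (rhomboids A)"
  by (rule finite_subset[of _ "Pow (Pow A)"])
     (auto simp: rhomboids_def comb_rhomboid_def A_in_def A_on_def)

lemma compact_geom_rhomboid:
  assumes "finite A" "R \<in> rhomboids A"
  shows "compact (geom_rhomboid R)"
proof -
  have "R \<subseteq> Pow A" using assms(2) by (auto simp: rhomboids_def comb_rhomboid_def A_in_def A_on_def)
  then have "finite R" using assms(1) by (simp add: finite_subset)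
  then show ?thesis by (simp add: geom_rhomboid_def finite_imp_compact_convex_hull)
qed

lemma sliced_rhomboid_compact_convex:
  fixes A :: "'a::euclidean_space set"
  assumes "finite A" "C \<in> sliced_rhomboids A"
  shows "compact C" "convex C"
proof -
  obtain R j where R: "R \<in> rhomboids A"
    "C = geom_rhomboid R \<inter> {x. snd x = - real j} \<or>
     C = geom_rhomboid R \<inter> {x. real j \<le> - snd x \<and> - snd x \<le> real j + 1}"
    using assms(2) by (auto simp: sliced_rhomboids_def)
  moreover have "{x::'a \<times> real. snd x = - real j} = UNIV \<times> {- real j}"
    "{x::'a \<times> real. real j \<le> - snd x \<and> - snd x \<le> real j + 1} = UNIV \<times> {- real j - 1..- real j}"
    by auto
  ultimately obtain T where T: "C = geom_rhomboid R \<inter> UNIV \<times> T" "T = {- real j} \<or> T = {- real j - 1..- real j}"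
    by metis
  then have "closed T" "convex T" by auto
  then have "closed (UNIV \<times> T :: ('a \<times> real) set)" "convex (UNIV \<times> T :: ('a \<times> real) set)"
    by (simp_all add: closed_Times convex_Times)
  moreover have "convex (geom_rhomboid R)" by (simp add: geom_rhomboid_def)
  ultimately show "compact C" "convex C"
    using compact_geom_rhomboid[OF assms(1) R(1)] T(1) by (simp_all add: compact_Int_closed convex_Int)
qed

text \<open>A compact convex cell is the hull of its extreme points, so their depth bound holds on
  the whole cell.\<close>

lemma sliced_k_ge_imp_depth:
  fixes A :: "'a::euclidean_space set"
  assumes "finite A" "C \<in> sliced_rhomboids A" "sliced_k_ge C k" "x \<in> C"
  shows "real k \<le> - snd x"
proof -
  have "C = convex hull {v. v extreme_point_of C}"
    using sliced_rhomboid_compact_convex[OF assms(1,2)] by (rule Krein_Milman_Minkowski)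
  also have "\<dots> \<subseteq> UNIV \<times> {..- real k}"
  proof (intro hull_minimal convex_Times subsetI)
    fix v assume "v \<in> {v. v extreme_point_of C}"
    then have "real k \<le> - snd v" using assms(3) unfolding sliced_k_ge_def by blast
    then show "v \<in> UNIV \<times> {..- real k}" by (simp add: mem_Times_iff)
  qed auto
  finally show ?thesis using assms(4) by (auto simp: mem_Times_iff)
qed

lemma rhomb_radius_approx:
  assumes "R \<in> rhomboids A" "rhomb_radius A R \<le> r" "0 < \<epsilon>"
  shows "\<exists>c \<rho>. 0 < \<rho> \<and> \<rho> \<le> r + \<epsilon> \<and> comb_rhomboid A c \<rho> = R"
proof -
  let ?S = "{\<rho>. 0 < \<rho> \<and> (\<exists>c. comb_rhomboid A c \<rho> = R)}"
  have "?S \<noteq> {}" using assms(1) by (auto simp: rhomboids_def)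
  moreover have "Inf ?S < r + \<epsilon>" using assms by (simp add: rhomb_radius_def)
  ultimately obtain \<rho> where "\<rho> \<in> ?S" "\<rho> < r + \<epsilon>" by (metis (lifting) cInf_lessD)
  then show ?thesis by force
qed

lemma rhomb_radius_le: "0 < \<rho> \<Longrightarrow> rhomb_radius A (comb_rhomboid A c \<rho>) \<le> \<rho>"
  unfolding rhomb_radius_def by (rule cInf_lower) (auto intro: bdd_belowI[of _ 0])

text \<open>There are finitely many rhomboids and one contains the cell, so the infimum is over a
  finite nonempty set.\<close>

lemma sliced_radius_attained:
  assumes "finite A" "C \<in> sliced_rhomboids A"
  obtains R where "R \<in> minimal_containing_rhomboids A C" "sliced_radius A C = rhomb_radius A R"
proof -
  let ?S = "{R \<in> rhomboids A. C \<subseteq> geom_rhomboid R}"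
  let ?M = "minimal_containing_rhomboids A C"
  have "finite ?S" "?S \<noteq> {}"
    using finite_rhomboids[OF assms(1)] assms(2) by (auto simp: sliced_rhomboids_def)
  from ex_is_arg_min_if_finite[OF this] obtain R
    where "is_arg_min (\<lambda>R. aff_dim (geom_rhomboid R)) (\<lambda>R. R \<in> ?S) R"
    by (rule exE)
  then have "R \<in> ?M"
    by (auto simp: is_arg_min_linorder minimal_containing_rhomboids_def)
  moreover have "finite ?M"
    using finite_rhomboids[OF assms(1)] by (simp add: minimal_containing_rhomboids_def)
  ultimately have "finite (rhomb_radius A ` ?M)" "rhomb_radius A ` ?M \<noteq> {}" by auto
  from cInf_eq_Min[OF this] Min_in[OF this] have "sliced_radius A C \<in> rhomb_radius A ` ?M"
    unfolding sliced_radius_def by simp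
  then show thesis using that by auto
qed

text \<open>Uniqueness of weights works in both directions: one weight vector serves all spheres
  approximating the radius of a rhomboid, and the smallest rhomboid containing a point can be read
  off its weights.\<close>

lemma S_Rhomb_eq_lifted:
  fixes A :: "'a::euclidean_space set"
  assumes fin: "finite A" and gp: "general_position A" and k: "1 \<le> k"
  shows "S_Rhomb A r k = lifted A ` del_weights A r k"
proof (intro Set.equalityI subsetI)
  fix x assume "x \<in> S_Rhomb A r k"
  then obtain C where C: "C \<in> sliced_rhomboids A" "sliced_radius A C \<le> r" "sliced_k_ge C k" "x \<in> C"
    by (auto simp: S_Rhomb_def)
  obtain R where R: "R \<in> rhomboids A" "C \<subseteq> geom_rhomboid R" "rhomb_radius A R \<le> r"
    using sliced_radius_attained[OF fin C(1)] C(2) unfolding minimal_containing_rhomboids_def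
    by (metis (no_types, lifting) mem_Collect_eq)
  have ex: "\<exists>l. x = lifted A l \<and> l \<in> cube A \<and> spherical A l c \<rho>" if "comb_rhomboid A c \<rho> = R" for c \<rho>
    using geom_comb_rhomboid[OF fin, of c \<rho>] R(2) C(4) that by auto
  obtain c0 \<rho>0 where c0: "0 < \<rho>0" "comb_rhomboid A c0 \<rho>0 = R"
    using R(1) by (auto simp: rhomboids_def)
  obtain l where l: "x = lifted A l" "l \<in> cube A" "spherical A l c0 \<rho>0"
    using ex[OF c0(2)] by blast
  have \<rho>0: "0 \<le> \<rho>0" using c0(1) by simp
  have depth: "real k \<le> sum l A"
    using sliced_k_ge_imp_depth[OF fin C(1,3,4)] by (simp add: l(1) lifted_def)
  then have "0 < sum l A" using k by simp
  then obtain a0 where a0: "a0 \<in> A" "0 < l a0"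
    by (meson not_less sum_nonpos)
  have "\<exists>c \<rho>. 0 \<le> \<rho> \<and> \<rho> \<le> r \<and> spherical A l c \<rho>"
  proof (rule spherical_limit[of a0 A l, OF a0])
    fix \<epsilon> :: real assume "0 < \<epsilon>"
    from rhomb_radius_approx[OF R(1,3) this] obtain c \<rho>
      where c: "0 < \<rho>" "\<rho> \<le> r + \<epsilon>" "comb_rhomboid A c \<rho> = R" by blast
    obtain m where m: "x = lifted A m" "m \<in> cube A" "spherical A m c \<rho>"
      using ex[OF c(3)] by blast
    have "l = m"
      using lifted_inj[OF gp fin l(2,3) \<rho>0 m(2,3)] c(1) l(1) m(1) by simp
    then show "\<exists>c \<rho>. 0 \<le> \<rho> \<and> \<rho> \<le> r + \<epsilon> \<and> spherical A l c \<rho>"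
      using c m(3) less_imp_le by blast
  qed
  then show "x \<in> lifted A ` del_weights A r k"
    using l(1,2) depth by (auto simp: del_weights_def)
next
  fix x assume "x \<in> lifted A ` del_weights A r k"
  then obtain l c \<rho> where l: "x = lifted A l" "l \<in> cube A" "real k \<le> sum l A"
    and c: "0 \<le> \<rho>" "\<rho> \<le> r" "spherical A l c \<rho>"
    by (auto simp: del_weights_def)
  let ?one = "{a \<in> A. l a = 1}" and ?frac = "{a \<in> A. 0 < l a \<and> l a < 1}"
  \<comment> \<open>The candidate for the smallest rhomboid: its free sites are those of fractional
    weight, so the point is in its relative interior.\<close>
  define R where "R = {?one \<union> Q | Q. Q \<subseteq> ?frac}"
  have "1 \<le> sum l A" using l(3) k by linarith
  have sphere: "\<exists>c' \<rho>'. 0 < \<rho>' \<and> \<rho>' < \<rho> + \<epsilon> \<and> comb_rhomboid A c' \<rho>' = R \<and> spherical A l c' \<rho>'"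
    if "0 < \<epsilon>" for \<epsilon>
  proof -
    obtain c' \<rho>' where c': "0 < \<rho>'" "\<rho>' < \<rho> + \<epsilon>" "A_in A c' \<rho>' = ?one" "A_on A c' \<rho>' = ?frac"
      using spherical_perturb[OF gp fin l(2) c(3,1) \<open>1 \<le> sum l A\<close> \<open>0 < \<epsilon>\<close>] by blast
    have "spherical A l c' \<rho>'"
      unfolding spherical_iff[OF l(2)]
    proof (intro conjI ballI)
      fix a assume a: "a \<in> {a \<in> A. \<rho>' < dist c' a}"
      then have "a \<notin> A_in A c' \<rho>'" "a \<notin> A_on A c' \<rho>'" by (auto simp: A_in_def A_on_def)
      with a c'(3,4) l(2) show "l a = 0" by (force simp: cube_def)
    qed (simp add: c'(3))
    moreover have "comb_rhomboid A c' \<rho>' = R" by (simp add: comb_rhomboid_def R_def c'(3,4))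
    ultimately show ?thesis using c'(1,2) by blast
  qed
  have R: "R \<in> rhomboids A" "x \<in> geom_rhomboid R"
    using sphere[of 1] l geom_comb_rhomboid[OF fin] by (auto simp: rhomboids_def)
  have "rhomb_radius A R \<le> r"
  proof (rule field_le_epsilon)
    fix \<epsilon> :: real assume "0 < \<epsilon>"
    from sphere[OF this] obtain c' \<rho>' where "0 < \<rho>'" "\<rho>' < \<rho> + \<epsilon>" "comb_rhomboid A c' \<rho>' = R" by blast
    with rhomb_radius_le[of \<rho>' A c'] c(2) show "rhomb_radius A R \<le> r + \<epsilon>" by simp
  qed
  \<comment> \<open>By uniqueness of weights, a rhomboid through \<open>x\<close> has inside sites
    only of weight 1, and all sites of positive weight are inside or on its sphere; so each vertex
    of \<open>R\<close> is one of its vertices.\<close>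
  have least: "R \<subseteq> R'" if R': "R' \<in> rhomboids A" "x \<in> geom_rhomboid R'" for R'
  proof -
    obtain c' \<rho>' where c': "0 < \<rho>'" "R' = comb_rhomboid A c' \<rho>'" using R' by (auto simp: rhomboids_def)
    then obtain m where m: "x = lifted A m" "m \<in> cube A" "spherical A m c' \<rho>'"
      using R'(2) geom_comb_rhomboid[OF fin] by auto
    then have "l = m"
      using lifted_inj[OF gp fin l(2) c(3,1) m(2,3)] c'(1) l(1) by simp
    with m(3) have sph: "spherical A l c' \<rho>'" by simp
    have sub: "A_in A c' \<rho>' \<subseteq> ?one" "?one \<union> ?frac \<subseteq> A_in A c' \<rho>' \<union> A_on A c' \<rho>'"
      using sph unfolding spherical_iff[OF l(2)]
      by (auto simp: A_in_def A_on_def)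
    show ?thesis
    proof
      fix v assume "v \<in> R"
      then have "A_in A c' \<rho>' \<subseteq> v" "v \<subseteq> A_in A c' \<rho>' \<union> A_on A c' \<rho>'"
        using sub by (auto simp: R_def)
      then show "v \<in> R'"
        unfolding c'(2) comb_rhomboid_def by (intro CollectI exI[of _ "v \<inter> A_on A c' \<rho>'"]) auto
    qed
  qed
  \<comment> \<open>The slab below the integer part of the depth contains \<open>x\<close> even at
    integral depth, and starts at depth \<open>k\<close> or more.\<close>
  define j where "j = nat \<lfloor>sum l A\<rfloor>"
  have j: "real j \<le> sum l A" "sum l A \<le> real j + 1" "k \<le> j"
    using l(3) unfolding j_def by (linarith | simp add: le_nat_floor)+
  have "sum l A \<le> real (card A)"
    using sum_bounded_above[of A l 1] l(2) by (auto simp: cube_def)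
  then have "j \<le> card A" using j(1) by linarith
  define C where "C = geom_rhomboid R \<inter> {x. real j \<le> - snd x \<and> - snd x \<le> real j + 1}"
  have "x \<in> C" using R(2) j by (simp add: C_def l(1) lifted_def)
  have "C \<in> sliced_rhomboids A"
    using \<open>x \<in> C\<close> \<open>j \<le> card A\<close> R(1) unfolding sliced_rhomboids_def C_def by fastforce
  have "sliced_k_ge C k"
    using j(3) by (auto simp: sliced_k_ge_def C_def extreme_point_of_def)
  \<comment> \<open>A rhomboid containing the cell contains \<open>x\<close>, hence the vertices of
    \<open>R\<close>, so its dimension is no smaller.\<close>
  have "R \<in> minimal_containing_rhomboids A C"
    unfolding minimal_containing_rhomboids_def
  proof (intro CollectI conjI ballI impI)
    fix R' assume "R' \<in> rhomboids A" "C \<subseteq> geom_rhomboid R'"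
    then have "R \<subseteq> R'" using \<open>x \<in> C\<close> least by auto
    then show "aff_dim (geom_rhomboid R) \<le> aff_dim (geom_rhomboid R')"
      unfolding geom_rhomboid_def by (intro aff_dim_subset hull_mono image_mono)
  qed (use R(1) in \<open>auto simp: C_def\<close>)
  moreover have "finite (minimal_containing_rhomboids A C)"
    using finite_rhomboids[OF fin] by (simp add: minimal_containing_rhomboids_def)
  ultimately have "sliced_radius A C \<le> rhomb_radius A R"
    unfolding sliced_radius_def by (intro cInf_lower) auto
  with \<open>rhomb_radius A R \<le> r\<close> have "sliced_radius A C \<le> r" by simp
  with \<open>x \<in> C\<close> \<open>C \<in> sliced_rhomboids A\<close> \<open>sliced_k_ge C k\<close> show "x \<in> S_Rhomb A r k"
    unfolding S_Rhomb_def by blast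
qed

section \<open>The homotopy equivalence\<close>

lemma continuous_on_mean: "continuous_on S (mean A)"
  unfolding mean_def
  by (intro continuous_on_coordinatewise_then_product continuous_on_sum
      continuous_on_product_then_coordinatewise[OF continuous_on_id])

lemma continuous_on_lifted:
  fixes A :: "'a::euclidean_space set"
  shows "continuous_on S (lifted A)"
  unfolding lifted_def
  by (intro continuous_intros continuous_on_product_then_coordinatewise[OF continuous_on_id])

lemma mean_convex_comb: "mean A (\<lambda>B. u * t B + w * s B) = (\<lambda>a. u * mean A t a + w * mean A s a)"
  by (rule ext) (simp add: mean_def sum.distrib sum_distrib_left)

text \<open>The fibres of \<open>mean A\<close> in the realization are convex, so the straight-line homotopy contracts
  them onto the section \<open>g\<close> given by systematic sampling.\<close>

lemma realization_homotopy_equivalence: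
  fixes A :: "'a::euclidean_space set"
  assumes fin: "finite A" and gp: "general_position A" and k: "1 \<le> k"
  shows "homotopy_equivalence_map (S_Del_bif A r k) (S_Rhomb_bif A r k) (lifted A \<circ> mean A)"
proof -
  let ?K = "realization (S_Del A r k)" and ?W = "del_weights A r k"
  obtain g :: "('a \<Rightarrow> real) \<Rightarrow> 'a set \<Rightarrow> real" where g:
      "continuous_on UNIV g"
      "\<And>l B. 0 \<le> g l B"
      "\<And>l B. g l B \<noteq> 0 \<Longrightarrow> B \<subseteq> A"
      "\<And>l. sum (g l) (Pow A) = 1"
      "\<And>l. l \<in> cube A \<Longrightarrow> mean A (g l) = l"
      "\<And>l B. l \<in> cube A \<Longrightarrow> g l B \<noteq> 0 \<Longrightarrow>
        {a \<in> A. l a = 1} \<subseteq> B \<and> B \<subseteq> {a \<in> A. 0 < l a} \<and> near_level (sum l A) (card B)"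
    by (fact sampling[OF fin])
  \<comment> \<open>A compact set of weights, independent of \<open>r\<close> and \<open>k\<close>:
    the inverse of \<open>lifted A\<close> is continuous on its image and is then
    restricted.\<close>
  define W where "W = {l \<in> cube A. \<exists>c \<rho>. 0 \<le> \<rho> \<and> spherical A l c \<rho>}"
  have sub: "?W \<subseteq> W" by (auto simp: W_def del_weights_def)
  have inj: "inj_on (lifted A) W"
    unfolding W_def inj_on_def using lifted_inj[OF gp fin] by blast
  define e where "e = inv_into W (lifted A)"
  have e: "e (lifted A l) = l" if "l \<in> ?W" for l
    using inj sub that by (auto simp: e_def)
  have "continuous_on (lifted A ` W) e"
    by (rule continuous_on_inv[OF continuous_on_lifted])
       (use compact_spherical[OF fin] inj in \<open>auto simp: W_def[symmetric] e_def\<close>)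
  then have cont_e: "continuous_on (lifted A ` ?W) e"
    by (rule continuous_on_subset) (use sub in auto)
  have meanW: "mean A t \<in> ?W" if "t \<in> ?K" for t
    using that by (simp add: realization_S_Del[OF fin k])
  have gK: "g l \<in> ?K" if "l \<in> ?W" for l
    using that g(2-6) by (simp add: realization_S_Del[OF fin k] del_weights_def)
  have Y: "S_Rhomb A r k = lifted A ` ?W"
    by (rule S_Rhomb_eq_lifted[OF fin gp k])
  have F: "continuous_map (S_Del_bif A r k) (S_Rhomb_bif A r k) (lifted A \<circ> mean A)"
    unfolding S_Del_bif_def S_Rhomb_bif_def continuous_map_subtopology_eu Y
    using meanW by (intro conjI continuous_on_compose continuous_on_mean continuous_on_lifted) auto
  have G: "continuous_map (S_Rhomb_bif A r k) (S_Del_bif A r k) (g \<circ> e)"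
    unfolding S_Del_bif_def S_Rhomb_bif_def continuous_map_subtopology_eu Y
    using gK e by (intro conjI continuous_on_compose cont_e continuous_on_subset[OF g(1)]) auto
  \<comment> \<open>Here the composite is the identity, since \<open>g\<close> is a section of
    \<open>mean A\<close>.\<close>
  have FG: "homotopic_with (\<lambda>x. True) (S_Rhomb_bif A r k) (S_Rhomb_bif A r k)
      ((lifted A \<circ> mean A) \<circ> (g \<circ> e)) id"
  proof (rule homotopic_with_equal)
    show "continuous_map (S_Rhomb_bif A r k) (S_Rhomb_bif A r k) ((lifted A \<circ> mean A) \<circ> (g \<circ> e))"
      using F G by (rule continuous_map_compose[rotated])
    fix x assume "x \<in> topspace (S_Rhomb_bif A r k)"
    then obtain l where "x = lifted A l" "l \<in> ?W" by (auto simp: S_Rhomb_bif_def Y)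
    then show "((lifted A \<circ> mean A) \<circ> (g \<circ> e)) x = id x"
      using e g(5) by (simp add: del_weights_def)
  qed simp_all
  have GF: "homotopic_with (\<lambda>x. True) (S_Del_bif A r k) (S_Del_bif A r k)
      ((g \<circ> e) \<circ> (lifted A \<circ> mean A)) id"
    unfolding S_Del_bif_def
  proof (subst homotopic_with; (intro exI conjI ballI)?)
    let ?h = "\<lambda>(s, t) B. (1 - s) * g (mean A t) B + s * t B"
    have "continuous_on ({0..1} \<times> ?K) (\<lambda>x. g (mean A (snd x)) B)" for B
      by (rule continuous_on_product_then_coordinatewise)
         (intro continuous_on_compose2[OF g(1)] continuous_on_compose2[OF continuous_on_mean[of UNIV]]
           continuous_intros; simp)
    moreover have "continuous_on ({0..1} \<times> ?K) (\<lambda>x. snd x B)" for B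
      by (rule continuous_on_product_then_coordinatewise) (rule continuous_on_snd[OF continuous_on_id])
    ultimately have "continuous_on ({0..1} \<times> ?K) ?h"
      unfolding split_beta by (intro continuous_on_coordinatewise_then_product continuous_intros)
    moreover have "?h (s, t) \<in> ?K" if s: "s \<in> {0..1}" and t: "t \<in> ?K" for s t
    proof -
      have "mean A (g (mean A t)) = mean A t" using meanW[OF t] g(5) by (simp add: del_weights_def)
      \<comment> \<open>The mean is constant along the segment, so the two endpoints obey the same
        size restrictions and the mean stays admissible.\<close>
      then have m: "mean A (?h (s, t)) = mean A t"
        unfolding split_conv mean_convex_comb by (simp add: left_diff_distrib)
      have "sum (?h (s, t)) (Pow A) = 1"
        using t g(4) by (simp add: realization_S_Del[OF fin k] sum.distrib flip: sum_distrib_left)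
      moreover have "B \<subseteq> A \<and> near_level (sum (mean A t) A) (card B)" if "?h (s, t) B \<noteq> 0" for B
      proof -
        have "g (mean A t) B \<noteq> 0 \<or> t B \<noteq> 0" using that by auto
        moreover have "mean A t \<in> cube A" using meanW[OF t] by (simp add: del_weights_def)
        moreover have "t B \<noteq> 0 \<Longrightarrow> B \<subseteq> A \<and> near_level (sum (mean A t) A) (card B)"
          using t by (simp add: realization_S_Del[OF fin k])
        ultimately show ?thesis using g(3,6) by blast
      qed
      moreover have "0 \<le> ?h (s, t) B" for B
        using s t g(2) by (simp add: realization_S_Del[OF fin k])
      ultimately show ?thesis
        unfolding realization_S_Del[OF fin k] mem_Collect_eq m using meanW[OF t] by blast
    qed
    ultimately show "continuous_map (prod_topology (top_of_set {0..1}) (top_of_set ?K)) (top_of_set ?K) ?h"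
      by (auto simp flip: subtopology_Times)
  qed (use e meanW in auto)
  show ?thesis
    unfolding homotopy_equivalence_map_def using F G FG GF by blast
qed

section \<open>Monotonicity in both parameters and conclusion\<close>

lemma subset_bifiltration:
  assumes "\<And>r k r' k'. r \<le> r' \<Longrightarrow> k' \<le> k \<Longrightarrow> S r k \<subseteq> S r' k'"
  shows "is_bifiltration (\<lambda>r k. top_of_set (S r k))"
  using assms unfolding is_bifiltration_def bif_le_def
  by (auto simp: subtopology_subtopology Int_absorb1)

lemma S_Rhomb_mono: "r \<le> r' \<Longrightarrow> k' \<le> k \<Longrightarrow> S_Rhomb A r k \<subseteq> S_Rhomb A r' k'"
  unfolding S_Rhomb_def sliced_k_ge_def by fastforce

lemma S_Del_mono: "r \<le> r' \<Longrightarrow> k' \<le> k \<Longrightarrow> S_Del A r k \<subseteq> S_Del A r' k'"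
proof -
  assume "r \<le> r'" "k' \<le> k"
  then have ball: "Ball_r r At \<subseteq> Ball_r r' At" for At :: "'a set" by (auto simp: Ball_r_def)
  have "(\<Inter>At\<in>\<sigma>. Ball_r r At \<inter> Vor A At) \<subseteq> (\<Inter>At\<in>\<sigma>. Ball_r r' At \<inter> Vor A At)" for \<sigma>
    using ball by (intro INT_anti_mono Int_mono) auto
  then have "Del_plus A r i \<subseteq> Del_plus A r' i" for i
    unfolding Del_plus_def by (intro Collect_mono) (metis subset_empty)
  with \<open>k' \<le> k\<close> show ?thesis unfolding S_Del_def by fastforce
qed

theorem theorem9:
  fixes A :: "'a::euclidean_space set"
  assumes "finite A" and "general_position A"
  shows "weakly_equivalent (S_Rhomb_bif A) (S_Del_bif A)"
proof -
  have "is_bifiltration (S_Rhomb_bif A)"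
    unfolding S_Rhomb_bif_def[abs_def] by (intro subset_bifiltration S_Rhomb_mono)
  moreover have "realization (S_Del A r k) \<subseteq> realization (S_Del A r' k')" if "r \<le> r'" "k' \<le> k" for r k r' k'
    using S_Del_mono[OF that, of A] by (auto simp: realization_def)
  then have "is_bifiltration (S_Del_bif A)"
    unfolding S_Del_bif_def[abs_def] by (rule subset_bifiltration)
  \<comment> \<open>The same map at every index makes compatibility with inclusions immediate;
    \<open>he_linked\<close> accepts either direction.\<close>
  moreover have "objectwise_he (S_Del_bif A) (S_Rhomb_bif A) (\<lambda>_ _. lifted A \<circ> mean A)"
    unfolding objectwise_he_def bif_morphism_def bif_index_def
  proof (intro conjI allI impI ballI)
    fix r :: real and k :: nat assume "0 \<le> r \<and> 1 \<le> k"
    then show he: "homotopy_equivalence_map (S_Del_bif A r k) (S_Rhomb_bif A r k) (lifted A \<circ> mean A)"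
      using realization_homotopy_equivalence[OF assms] by blast
    then show "continuous_map (S_Del_bif A r k) (S_Rhomb_bif A r k) (lifted A \<circ> mean A)"
      unfolding homotopy_equivalence_map_def by (rule conjunct1)
  qed (rule refl)
  ultimately show ?thesis
    unfolding weakly_equivalent_def he_linked_def by blast
qed

end
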